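(* Let $X$ be a metrizable space with $|X| \leq \mathfrak{c}^{+\omega}$. Then $X$ is $2^\omega$-partitionable if and only if $X$ is $2^\omega$-coverable.
   Context: $\mathfrak{c} = 2^{\aleph_0}$. Put $\mathfrak{c}^{+0} = \mathfrak{c}$, $\mathfrak{c}^{+(n+1)} = (\mathfrak{c}^{+n})^+$ (cardinal successor), and $\mathfrak{c}^{+\omega} = \sup_{n<\omega} \mathfrak{c}^{+n}$, the least limit cardinal above $\mathfrak{c}$. $2^\omega$ denotes the Cantor space. A space $X$ is $2^\omega$-partitionable if there is a partition of $X$ (a family of pairwise disjoint subsets with union $X$) each member of which, with the subspace topology, is homeomorphic to $2^\omega$. A space $X$ is $2^\omega$-coverable if there is a family of subsets of $X$ with union $X$, each member of which, with the subspace topology, is homeomorphic to $2^\omega$. *)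

theory Defs
  imports "HOL-Analysis.Analysis"
begin

unbundle cardinal_syntax
no_notation elt_set_eq (infix \<open>=o\<close> 50)

abbreviation cantor_space :: "(nat \<Rightarrow> bool) topology"
  where "cantor_space \<equiv> product_topology (\<lambda>_. discrete_topology UNIV) UNIV"

definition cantor_partitionable :: "'a topology \<Rightarrow> bool"
  where "cantor_partitionable X \<longleftrightarrow>
    (\<exists>P. partition_on (topspace X) P \<and> (\<forall>C\<in>P. subtopology X C homeomorphic_space cantor_space))"

definition cantor_coverable :: "'a topology \<Rightarrow> bool"
  where "cantor_coverable X \<longleftrightarrow>
    (\<exists>P. \<Union>P = topspace X \<and> (\<forall>C\<in>P. subtopology X C homeomorphic_space cantor_space))"

abbreviation continuum :: "(nat \<Rightarrow> bool) rel"
  where "continuum \<equiv> ctwo ^c natLeq"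

text \<open>
  The library's \<open>cardSuc\<close> maps a cardinal on \<open>'k\<close> to one on \<open>'k set\<close>, so iterating it \<open>n\<close> times
  would need a type depending on \<open>n\<close>.  Instead, \<open>is_continuum_plus n r\<close> says that the cardinal \<open>r\<close>,
  on whatever type, is the \<open>n\<close>-th successor of the continuum.  Keeping all the predecessors on the
  same type \<open>'k\<close> is no restriction, since they are smaller than \<open>r\<close>.
\<close>

primrec is_continuum_plus :: "nat \<Rightarrow> 'k rel \<Rightarrow> bool"
  where
    "is_continuum_plus 0 r \<longleftrightarrow> Card_order r \<and> r =o continuum"
  | "is_continuum_plus (Suc n) r \<longleftrightarrow>
       Card_order r \<and> (\<exists>s :: 'k rel. is_continuum_plus n s \<and> r =o cardSuc s)"

definition is_continuum_plus_omega :: "'k rel \<Rightarrow> bool"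
  where "is_continuum_plus_omega r \<longleftrightarrow> Card_order r \<and>
    (\<forall>n. \<exists>s :: 'k rel. is_continuum_plus n s \<and> s \<le>o r) \<and>
    (\<forall>t :: 'k rel. Card_order t \<and> (\<forall>n s :: 'k rel. is_continuum_plus n s \<longrightarrow> s \<le>o t) \<longrightarrow> r \<le>o t)"

text \<open>
  A type \<open>'a\<close> that carries no cardinal satisfying \<open>is_continuum_plus_omega\<close> is smaller than that
  cardinal, and then so is every set \<open>A\<close> of elements of \<open>'a\<close>; the condition below is then rightly
  true.  Postulating the cardinal on some other type instead would not do: HOL does not prove that
  there is a type large enough to carry it.  Where there is one, the two formulations agree; see
  \<open>card_le_continuum_plus_omega_iff\<close>.
\<close>

definition card_le_continuum_plus_omega :: "'a set \<Rightarrow> bool"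
  where "card_le_continuum_plus_omega A \<longleftrightarrow>
    (\<forall>r :: 'a rel. is_continuum_plus_omega r \<longrightarrow> |A| \<le>o r)"

lemma is_continuum_plus_Card_order: "is_continuum_plus n r \<Longrightarrow> Card_order r"
  by (cases n) auto

lemma Card_order_transfer:
  fixes r :: "'a rel" and s :: "'b rel"
  assumes "Card_order r" "r \<le>o s"
  obtains t :: "'b rel" where "Card_order t" "t =o r"
proof -
  have "|Field r| =o r"
    using assms(1) by (rule card_of_Field_ordIso)
  moreover obtain f :: "'a \<Rightarrow> 'b" where f: "inj_on f (Field r)"
    using card_of_mono2[OF assms(2)] by (auto simp: card_of_ordLeq[symmetric])
  then have "|f ` Field r| =o |Field r|"
    using card_of_ordIsoI[OF inj_on_imp_bij_betw[OF f]] by (blast intro: ordIso_symmetric)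
  ultimately have "|f ` Field r| =o r"
    by (blast intro: ordIso_transitive)
  with that card_of_Card_order show thesis by blast
qed

lemma is_continuum_plus_unique:
  fixes r :: "'a rel" and s :: "'b rel"
  assumes "is_continuum_plus n r" "is_continuum_plus n s"
  shows "r =o s"
  using assms
proof (induction n arbitrary: r s)
  case 0
  then show ?case by (auto intro: ordIso_transitive ordIso_symmetric)
next
  case (Suc n)
  then obtain r' :: "'a rel" and s' :: "'b rel"
    where *: "is_continuum_plus n r'" "r =o cardSuc r'" "is_continuum_plus n s'" "s =o cardSuc s'"
    by auto
  have "cardSuc r' =o cardSuc s'"
    using Suc.IH[OF *(1,3)] * is_continuum_plus_Card_order
    by (metis cardSuc_invar_ordIso)
  with * show ?case by (meson ordIso_transitive ordIso_symmetric)
qed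

lemma is_continuum_plus_transfer:
  fixes r :: "'a rel" and s :: "'b rel"
  assumes "is_continuum_plus n r" "Card_order s" "s =o r"
  shows "is_continuum_plus n s"
  using assms
proof (induction n arbitrary: r s)
  case 0
  then show ?case by (auto intro: ordIso_transitive)
next
  case (Suc n)
  then obtain r' :: "'a rel" where r': "is_continuum_plus n r'" "r =o cardSuc r'" by auto
  have co: "Card_order r'" using r' is_continuum_plus_Card_order by blast
  have so: "s =o cardSuc r'" using Suc.prems(3) r'(2) by (rule ordIso_transitive)
  have "r' \<le>o s"
    using cardSuc_ordLeq[OF co] so by (meson ordIso_symmetric ordLeq_ordIso_trans)
  then obtain s' :: "'b rel" where s': "Card_order s'" "s' =o r'"
    using Card_order_transfer[OF co] by blast
  have "is_continuum_plus n s'" using Suc.IH[OF r'(1) s'] .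
  moreover have "s =o cardSuc s'"
    using so s' co by (meson cardSuc_invar_ordIso ordIso_symmetric ordIso_transitive)
  ultimately show ?case using Suc.prems(2) by auto
qed

lemma is_continuum_plus_omega_upper:
  fixes r :: "'a rel" and s :: "'b rel"
  assumes "is_continuum_plus_omega r" "is_continuum_plus n s"
  shows "s \<le>o r"
  using assms is_continuum_plus_unique unfolding is_continuum_plus_omega_def
  by (meson ordIso_ordLeq_trans)

lemma is_continuum_plus_omega_least:
  fixes r :: "'a rel" and t :: "'b rel"
  assumes "is_continuum_plus_omega r" "Card_order t"
    and "\<And>n s :: 'a rel. is_continuum_plus n s \<Longrightarrow> s \<le>o t"
  shows "r \<le>o t"
proof (rule ccontr)
  assume n: "\<not> r \<le>o t"
  have cr: "Card_order r" using assms(1) by (simp add: is_continuum_plus_omega_def)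
  have lt: "t <o r"
    using n cr assms(2) unfolding card_order_on_def by (metis not_ordLeq_iff_ordLess)
  then obtain u :: "'a rel" where u: "Card_order u" "u =o t"
    using Card_order_transfer[OF assms(2) ordLess_imp_ordLeq] by blast
  have "r \<le>o u"
    using assms(1,3) u unfolding is_continuum_plus_omega_def
    by (meson ordLeq_ordIso_trans ordIso_symmetric)
  with u n show False by (meson ordLeq_ordIso_trans)
qed

lemma card_le_continuum_plus_omega_iff:
  fixes A :: "'a set" and k :: "'k rel"
  assumes k: "is_continuum_plus_omega k"
  shows "card_le_continuum_plus_omega A \<longleftrightarrow> |A| \<le>o k"
proof
  assume A: "|A| \<le>o k"
  show "card_le_continuum_plus_omega A"
    unfolding card_le_continuum_plus_omega_def
  proof (intro allI impI)
    fix r :: "'a rel" assume r: "is_continuum_plus_omega r"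
    have "k \<le>o r"
      using k r is_continuum_plus_omega_upper is_continuum_plus_omega_least
      by (metis is_continuum_plus_omega_def)
    with A show "|A| \<le>o r" by (rule ordLeq_transitive)
  qed
next
  assume A: "card_le_continuum_plus_omega A"
  show "|A| \<le>o k"
  proof (rule ccontr)
    assume n: "\<not> |A| \<le>o k"
    have ck: "Card_order k" using k by (simp add: is_continuum_plus_omega_def)
    have lt: "k <o |A|"
      using n ck card_of_Well_order unfolding card_order_on_def by (metis not_ordLeq_iff_ordLess)
    then obtain r :: "'a rel" where r: "Card_order r" "r =o k"
      using Card_order_transfer[OF ck ordLess_imp_ordLeq] by blast
    have ex: "\<exists>s :: 'a rel. is_continuum_plus n s \<and> s \<le>o r" for n
    proof -
      obtain s :: "'k rel" where s: "is_continuum_plus n s" "s \<le>o k"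
        using k unfolding is_continuum_plus_omega_def by blast
      have sr: "s \<le>o r" using s r by (meson ordLeq_ordIso_trans ordIso_symmetric)
      obtain t :: "'a rel" where t: "Card_order t" "t =o s"
        using Card_order_transfer[OF is_continuum_plus_Card_order[OF s(1)] sr] by blast
      show ?thesis using is_continuum_plus_transfer[OF s(1) t] t sr ordIso_ordLeq_trans by blast
    qed
    have "r \<le>o t" if t: "Card_order t" "\<forall>n s :: 'a rel. is_continuum_plus n s \<longrightarrow> s \<le>o t"
      for t :: "'a rel"
    proof -
      have "k \<le>o t"
        using k t(1)
      proof (rule is_continuum_plus_omega_least)
        fix n and s :: "'k rel" assume s: "is_continuum_plus n s"
        obtain s' :: "'a rel" where "is_continuum_plus n s'" using ex by blast
        with s t show "s \<le>o t" using is_continuum_plus_unique ordIso_ordLeq_trans by blast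
      qed
      with r show ?thesis by (meson ordIso_ordLeq_trans)
    qed
    with r ex have "is_continuum_plus_omega r"
      unfolding is_continuum_plus_omega_def by blast
    with A have "|A| \<le>o r" unfolding card_le_continuum_plus_omega_def by blast
    with r n show False by (meson ordLeq_ordIso_trans)
  qed
qed

end

theory Submission
  imports Defs
begin

text \<open>
  Let \<open>\<A>\<close> be a maximal disjoint family of Cantor subsets of \<open>X\<close>.  Every ball meets a member of \<open>\<A>\<close>,
  so each point \<open>y\<close> outside \<open>\<Union>\<A>\<close> can be absorbed by cutting, for every \<open>n\<close>, a small Cantor set
  within distance \<open>2^-n\<close> of \<open>y\<close> out of some member of \<open>\<A>\<close>: these pieces together with \<open>y\<close> again form a
  Cantor set.  A member \<open>A\<close> splits into continuum many Cantor sets, so it survives up to continuum many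
  such cuts, and it remains to choose the victims so that no \<open>A\<close> is chosen more often than that.

  A ball \<open>B\<close> lies in the closure of the members of \<open>\<A>\<close> meeting it.  If \<open>L\<close> is the set of their points,
  then \<open>|B| \<le> |L|\<^sup>\<omega>\<close>, and as \<open>\<lambda>\<^sup>\<omega> = \<lambda>\<close> for \<open>\<lambda> = c\<^sup>+\<^sup>n\<close>, the bound on \<open>|X|\<close> gives \<open>|B| \<le> |L|\<close>.
  Hence, locally, there are as many candidate victims (up to a factor \<open>c\<close>) as there are points, and an
  injective choice is possible.
\<close>

subsection \<open>Cardinal arithmetic\<close>

lemma continuum_eq_card_UNIV: "continuum = |UNIV :: (nat \<Rightarrow> bool) set|"
  by (simp add: cexp_def ctwo_def Field_card_of Field_natLeq Func_def)

lemma natLeq_ordLeq_continuum: "natLeq \<le>o continuum"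
proof -
  have "|UNIV :: nat set| \<le>o |UNIV :: (nat \<Rightarrow> bool) set|"
    by (rule card_of_ordLeq[THEN iffD1], rule exI[where x = "\<lambda>n i. i = n"]) (auto simp: inj_def fun_eq_iff)
  then show ?thesis
    unfolding continuum_eq_card_UNIV
    by (rule ordIso_ordLeq_trans[OF ordIso_symmetric[OF card_of_nat]])
qed

lemma continuum_ordLeq_is_continuum_plus:
  fixes r :: "'a rel"
  shows "is_continuum_plus n r \<Longrightarrow> continuum \<le>o r"
proof (induction n arbitrary: r)
  case 0
  then show ?case by (auto intro: ordIso_imp_ordLeq ordIso_symmetric)
next
  case (Suc n)
  then obtain s :: "'a rel" where s: "is_continuum_plus n s" "r =o cardSuc s" by auto
  have "s \<le>o r"
    by (rule ordLeq_ordIso_trans[OF cardSuc_ordLeq ordIso_symmetric[OF s(2)]])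
      (rule is_continuum_plus_Card_order[OF s(1)])
  with Suc.IH[OF s(1)] show ?case by (rule ordLeq_transitive)
qed

lemma infinite_of_natLeq:
  assumes "natLeq \<le>o r" "Card_order r"
  shows "infinite (Field r)"
  using cinfinite_mono[OF assms(1) natLeq_cinfinite] by (simp add: cinfinite_def)

lemma infinite_of_continuum:
  assumes "continuum \<le>o |A|"
  shows "infinite A"
  using infinite_of_natLeq[OF ordLeq_transitive[OF natLeq_ordLeq_continuum assms] card_of_Card_order]
  by (simp add: Field_card_of)

text \<open>Every sequence in a successor cardinal is bounded; this is the countable case of Hausdorff's formula.\<close>

lemma cexp_natLeq_cardSuc:
  assumes s: "Card_order s" "natLeq \<le>o s" and pow: "s ^c natLeq \<le>o s"
  shows "cardSuc s ^c natLeq \<le>o cardSuc s"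
proof -
  let ?R = "cardSuc s"
  have inf: "infinite (Field s)" using infinite_of_natLeq[OF s(2,1)] .
  have R: "Card_order ?R" "infinite (Field ?R)"
    using s(1) inf by (simp_all add: cardSuc_Card_order cardSuc_finite)
  have wo: "Well_order ?R" using R(1) by (simp add: card_order_on_def)
  have under: "|under ?R i| \<le>o s" if i: "i \<in> Field ?R" for i
  proof -
    have "|underS ?R i| <o ?R" using R(1) i by (rule card_of_underS)
    moreover have "|{i}| <o ?R"
      using wo R(2) by (intro finite_ordLess_infinite) (auto simp: card_of_well_order_on Field_card_of)
    ultimately have "|underS ?R i \<union> {i}| <o ?R"
      using R by (intro card_of_Un_ordLess_infinite_Field)
    moreover have "under ?R i \<subseteq> underS ?R i \<union> {i}"
      by (auto simp: under_def underS_def)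
    ultimately have "|under ?R i| <o ?R"
      using ordLeq_ordLess_trans[OF card_of_mono1] by blast
    then show ?thesis
      using cardSuc_ordLeq_ordLess[OF s(1) card_of_Card_order] by blast
  qed
  \<comment> \<open>There are \<open>cardSuc s\<close> many initial segments, and each receives at
    most \<open>s ^c natLeq \<le>o s\<close> sequences.\<close>
  have "|\<Union>i\<in>Field ?R. Func (Field natLeq) (under ?R i)| \<le>o ?R"
  proof (rule card_of_UNION_ordLeq_infinite_Field[OF R(2,1)])
    show "|Field ?R| \<le>o ?R"
      using card_of_Field_ordIso[OF R(1)] by (rule ordIso_imp_ordLeq)
    show "\<forall>i\<in>Field ?R. |Func (Field natLeq) (under ?R i)| \<le>o ?R"
    proof
      fix i assume "i \<in> Field ?R"
      then have "|under ?R i| ^c natLeq \<le>o s ^c natLeq"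
        by (intro cexp_mono1 under natLeq_Card_order)
      then have "|under ?R i| ^c natLeq \<le>o ?R"
        by (rule ordLeq_transitive[OF _ ordLeq_transitive[OF pow cardSuc_ordLeq[OF s(1)]]])
      then show "|Func (Field natLeq) (under ?R i)| \<le>o ?R"
        by (simp add: cexp_def Field_card_of)
    qed
  qed
  moreover have "Func (Field natLeq) (Field ?R) \<subseteq> (\<Union>i\<in>Field ?R. Func (Field natLeq) (under ?R i))"
  proof
    fix f assume f: "f \<in> Func (Field natLeq) (Field ?R)"
    have "|range f| \<le>o s"
      by (rule ordLeq_transitive[OF ordLeq_ordIso_trans[OF card_of_image card_of_nat] s(2)])
    moreover have "range f \<subseteq> (\<Union>i\<in>Field ?R. under ?R i)"
    proof -
      have "f n \<in> under ?R (f n)" for n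
        using f wo by (auto simp: Func_def under_def Field_natLeq order_on_defs refl_on_def)
      with f show ?thesis by (auto simp: Func_def Field_natLeq)
    qed
    moreover have "relChain ?R (under ?R)"
    proof -
      have "trans ?R" using wo by (simp add: order_on_defs)
      then show ?thesis unfolding relChain_def by (simp add: under_incr)
    qed
    \<comment> \<open>Regularity of the successor: a set of at most \<open>s\<close> elements
      covered by the increasing initial segments lies inside one of them.\<close>
    ultimately obtain i where "i \<in> Field ?R" "range f \<subseteq> under ?R i"
      using cardSuc_UNION[OF s(1) inf] by blast
    then show "f \<in> (\<Union>i\<in>Field ?R. Func (Field natLeq) (under ?R i))"
      using f by (auto simp: Func_def)
  qed
  ultimately show ?thesis
    unfolding cexp_def by (blast intro: ordLeq_transitive[OF card_of_mono1])
qed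

text \<open>Induction starting from (2^N)^N = 2^(N x N) = 2^N, with Hausdorff's formula as the
  successor step.\<close>

lemma cexp_natLeq_is_continuum_plus:
  fixes r :: "'a rel"
  shows "is_continuum_plus n r \<Longrightarrow> r ^c natLeq \<le>o r"
proof (induction n arbitrary: r)
  case 0
  then have r: "Card_order r" "r =o continuum" by auto
  have "r ^c natLeq =o continuum ^c natLeq"
    using r(2) natLeq_Card_order by (rule cexp_cong1)
  also have "continuum ^c natLeq =o continuum"
    by (rule cexp_cprod_ordLeq[OF Card_order_ctwo natLeq_Cinfinite
          Cinfinite_Cnotzero[OF natLeq_Cinfinite] ordLeq_refl[OF natLeq_Card_order]])
  also have "continuum =o r" using r(2) by (rule ordIso_symmetric)
  finally show ?case by (rule ordIso_imp_ordLeq)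
next
  case (Suc n)
  then obtain s :: "'a rel" where s: "is_continuum_plus n s" "r =o cardSuc s" by auto
  have "cardSuc s ^c natLeq \<le>o cardSuc s"
    by (rule cexp_natLeq_cardSuc[OF is_continuum_plus_Card_order[OF s(1)]
          ordLeq_transitive[OF natLeq_ordLeq_continuum continuum_ordLeq_is_continuum_plus[OF s(1)]]
          Suc.IH[OF s(1)]])
  then show ?case
    by (rule ordIso_ordLeq_trans[OF cexp_cong1[OF s(2) natLeq_Card_order]
          ordLeq_ordIso_trans[OF _ ordIso_symmetric[OF s(2)]]])
qed

text \<open>If \<open>t\<close> were no finite successor of the continuum, induction would place all
  of these below \<open>t\<close>. Being bounded on the type \<open>'a\<close>, they have a least
  upper bound there, which bounds \<open>|S|\<close> by assumption; this contradicts
  \<open>t <o |S|\<close>.\<close>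

lemma is_continuum_plus_below:
  fixes S :: "'a set" and t :: "'a rel"
  assumes S: "card_le_continuum_plus_omega S"
    and t: "Card_order t" "continuum \<le>o t" "t <o |S|"
  obtains n where "is_continuum_plus n t"
proof (rule ccontr)
  assume "\<not> thesis"
  with that have no: "\<not> is_continuum_plus n t" for n by blast
  have ex: "\<exists>s :: 'a rel. is_continuum_plus n s \<and> s \<le>o t" for n
  proof (induction n)
    case 0
    obtain s :: "'a rel" where "Card_order s" "s =o continuum"
      using Card_order_transfer[OF Card_order_cexp t(2)] by blast
    then show ?case using t(2) ordIso_ordLeq_trans by auto
  next
    case (Suc n)
    then obtain s :: "'a rel" where s: "is_continuum_plus n s" "s \<le>o t" by blast
    have cs: "Card_order s" using s(1) by (rule is_continuum_plus_Card_order)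
    \<comment> \<open>Equality would make \<open>t\<close> the \<open>n\<close>-th successor; hence
      \<open>t\<close> lies strictly above \<open>s\<close> and so above
      \<open>cardSuc s\<close>.\<close>
    have "\<not> t =o s"
      using is_continuum_plus_transfer[OF s(1) t(1)] no by blast
    with s(2) have "s <o t"
      using ordLeq_iff_ordLess_or_ordIso ordIso_symmetric by blast
    then have suc: "cardSuc s \<le>o t"
      using cs t(1) by (simp add: cardSuc_ordLess_ordLeq)
    then obtain u :: "'a rel" where u: "Card_order u" "u =o cardSuc s"
      using Card_order_transfer[OF cardSuc_Card_order[OF cs]] by blast
    then have "is_continuum_plus (Suc n) u" using s(1) by auto
    with u suc ordIso_ordLeq_trans show ?case by blast
  qed
  \<comment> \<open>The upper bounds on \<open>'a\<close>. The witness \<open>t\<close> makes this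
    set nonempty, and a least element of it is the limit cardinal itself.\<close>
  define R where "R = {u :: 'a rel. Card_order u \<and> (\<forall>n s :: 'a rel. is_continuum_plus n s \<longrightarrow> s \<le>o u)}"
  have tR: "t \<in> R"
    unfolding R_def
  proof (clarsimp simp: t(1))
    fix n and s :: "'a rel" assume s: "is_continuum_plus n s"
    obtain s' :: "'a rel" where s': "is_continuum_plus n s'" "s' \<le>o t" using ex by blast
    show "s \<le>o t" by (rule ordIso_ordLeq_trans[OF is_continuum_plus_unique[OF s s'(1)] s'(2)])
  qed
  have "\<exists>r\<in>R. \<forall>r'\<in>R. r \<le>o r'"
    by (rule exists_minim_Card_order) (use tR in \<open>auto simp: R_def\<close>)
  then obtain r where r: "r \<in> R" "\<forall>r'\<in>R. r \<le>o r'" by blast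
  have "is_continuum_plus_omega r"
    unfolding is_continuum_plus_omega_def
    using r ex unfolding R_def by simp blast
  then have "|S| \<le>o r" using S unfolding card_le_continuum_plus_omega_def by blast
  then have "|S| \<le>o t" by (rule ordLeq_transitive) (use r(2) tR in blast)
  with t(3) show False by (simp add: not_ordLess_ordLeq)
qed

text \<open>Otherwise \<open>|L|\<close> would lie between the continuum and \<open>|S|\<close>,
  hence be a finite successor of the continuum, and these absorb countable powers. The bound on the
  size of the space enters the proof here.\<close>

lemma ordLeq_of_ordLeq_cexp_natLeq:
  fixes B S :: "'a set" and L :: "'b set"
  assumes S: "card_le_continuum_plus_omega S" "B \<subseteq> S"
    and L: "continuum \<le>o |L|" and B: "|B| \<le>o |L| ^c natLeq"
  shows "|B| \<le>o |L|"
proof (rule ccontr)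
  assume "\<not> |B| \<le>o |L|"
  then have lt: "|L| <o |B|" by (simp add: not_ordLeq_iff_ordLess card_of_Well_order)
  \<comment> \<open>A copy of \<open>|L|\<close> on \<open>'a\<close>, the type on which the
    hypothesis about \<open>S\<close> speaks.\<close>
  then obtain t :: "'a rel" where t: "Card_order t" "t =o |L|"
    using Card_order_transfer[OF card_of_Card_order ordLess_imp_ordLeq] by blast
  have "continuum \<le>o t"
    by (rule ordLeq_ordIso_trans[OF L ordIso_symmetric[OF t(2)]])
  moreover have "t <o |S|"
    by (rule ordIso_ordLess_trans[OF t(2) ordLess_ordLeq_trans[OF lt card_of_mono1[OF S(2)]]])
  ultimately obtain n where "is_continuum_plus n t"
    using is_continuum_plus_below[OF S(1) t(1)] by blast
  then have "|L| ^c natLeq \<le>o |L|"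
    by (rule cexp_natLeq_is_continuum_plus[OF
          is_continuum_plus_transfer[OF _ card_of_Card_order ordIso_symmetric[OF t(2)]]])
  with B have "|B| \<le>o |L|" by (rule ordLeq_transitive)
  with lt show False by (simp add: not_ordLess_ordLeq)
qed

text \<open>Transfinite recursion along the well-order \<open>|I|\<close>: every proper initial
  segment has fewer than \<open>|I|\<close> elements, so the values already taken never exhaust
  \<open>S i\<close>.\<close>

lemma injective_choice:
  fixes I :: "'i set" and S :: "'i \<Rightarrow> 'b set"
  assumes "\<And>i. i \<in> I \<Longrightarrow> |I| \<le>o |S i|"
  obtains f where "inj_on f I" "\<And>i. i \<in> I \<Longrightarrow> f i \<in> S i"
proof -
  let ?r = "|I|"
  have wo: "Well_order ?r" and fld: "Field ?r = I" by (simp_all add: card_of_well_order_on Field_card_of)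
  define f where "f = wfrec (?r - Id) (\<lambda>g i. SOME s. s \<in> S i - g ` underS ?r i)"
  have wf: "wf (?r - Id)" using wo by (simp add: order_on_defs)
  have rec: "f i = (SOME s. s \<in> S i - f ` underS ?r i)" for i
  proof -
    have "cut f (?r - Id) i ` underS ?r i = f ` underS ?r i"
      by (rule image_cong) (auto simp: cut_def underS_def)
    then show ?thesis
      by (subst def_wfrec[OF f_def[THEN eq_reflection] wf]) (simp only:)
  qed
  have f: "f i \<in> S i - f ` underS ?r i" if i: "i \<in> I" for i
  proof -
    have "|underS ?r i| <o ?r"
      using card_of_Card_order by (rule card_of_underS) (simp add: fld i)
    then have "|f ` underS ?r i| <o |S i|"
      by (rule ordLess_ordLeq_trans[OF ordLeq_ordLess_trans[OF card_of_image] assms[OF i]])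
    then have "\<not> S i \<subseteq> f ` underS ?r i"
      using card_of_mono1 not_ordLess_ordLeq by blast
    then have "\<exists>s. s \<in> S i - f ` underS ?r i" by blast
    then show ?thesis unfolding rec[of i] by (rule someI_ex)
  qed
  have "inj_on f I"
  proof (rule inj_onI, rule ccontr)
    fix i j assume ij: "i \<in> I" "j \<in> I" "f i = f j" "i \<noteq> j"
    then have "i \<in> underS ?r j \<or> j \<in> underS ?r i"
      using wo fld by (auto simp: order_on_defs total_on_def underS_def)
    then show False using ij f[of i] f[of j] by (metis DiffD2 imageI)
  qed
  with f that show thesis by blast
qed

subsection \<open>Cantor sets\<close>

text \<open>A parametrised form of being homeomorphic to the Cantor space. Composing and gluing
  parametrisations is easier than handling subspace topologies.\<close>

definition cantor_set :: "'a topology \<Rightarrow> 'a set \<Rightarrow> bool"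
  where "cantor_set X C \<longleftrightarrow> (\<exists>h. continuous_map cantor_space X h \<and> inj h \<and> range h = C)"

lemma cantor_setE:
  assumes "cantor_set X C"
  obtains h where "continuous_map cantor_space X h" "inj h" "range h = C"
  using assms unfolding cantor_set_def by blast

lemma cantor_set_subset_topspace:
  assumes "cantor_set X C"
  shows "C \<subseteq> topspace X"
proof -
  obtain h where h: "continuous_map cantor_space X h" "inj h" "range h = C"
    using assms by (rule cantor_setE)
  from continuous_map_image_subset_topspace[OF h(1)] h(3) show ?thesis by simp
qed

lemma cantor_set_nonempty: "cantor_set X C \<Longrightarrow> C \<noteq> {}"
  by (erule cantor_setE) blast

lemma card_of_cantor_set:
  assumes "cantor_set X C"
  shows "|C| \<le>o continuum"
proof -
  obtain h :: "(nat \<Rightarrow> bool) \<Rightarrow> 'a" where h: "range h = C"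
    using assms by (rule cantor_setE)
  show ?thesis unfolding continuum_eq_card_UNIV h[symmetric] by (rule card_of_image)
qed

text \<open>From right to left: a continuous bijection from a compact space onto a Hausdorff space
  is a homeomorphism.\<close>

lemma homeomorphic_cantor_space_iff:
  assumes "Hausdorff_space X" "C \<subseteq> topspace X"
  shows "subtopology X C homeomorphic_space cantor_space \<longleftrightarrow> cantor_set X C"
proof
  assume "subtopology X C homeomorphic_space cantor_space"
  then have "cantor_space homeomorphic_space subtopology X C"
    by (rule homeomorphic_space_sym[THEN iffD1])
  then obtain h where h: "homeomorphic_map cantor_space (subtopology X C) h"
    unfolding homeomorphic_space by blast
  then have "range h = C" "inj h"
    using assms(2) homeomorphic_imp_surjective_map[OF h] homeomorphic_imp_injective_map[OF h]
    by (simp_all add: inf_absorb2)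
  moreover have "continuous_map cantor_space X h"
    using homeomorphic_imp_continuous_map[OF h] by (simp add: continuous_map_in_subtopology)
  ultimately show "cantor_set X C" unfolding cantor_set_def by blast
next
  assume "cantor_set X C"
  then obtain h where h: "continuous_map cantor_space X h" "inj h" "range h = C"
    unfolding cantor_set_def by blast
  have "homeomorphic_map cantor_space (subtopology X C) h"
  proof (rule continuous_imp_homeomorphic_map)
    show "compact_space cantor_space"
      by (simp add: compact_space_product_topology compact_space_discrete_topology)
    show "Hausdorff_space (subtopology X C)"
      using assms(1) by (rule Hausdorff_space_subtopology)
  qed (use h assms(2) in \<open>auto simp: continuous_map_in_subtopology\<close>)
  then show "subtopology X C homeomorphic_space cantor_space"
    by (rule homeomorphic_space_sym[THEN iffD1, OF homeomorphic_map_imp_homeomorphic_space])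
qed

section \<open>Cylinders, subcubes and fine partitions of Cantor sets\<close>

lemma continuous_map_cantor_space_nth: "continuous_map cantor_space (discrete_topology UNIV) (\<lambda>g. g i)"
  using continuous_map_product_projection[of i UNIV "\<lambda>_. discrete_topology UNIV"] by simp

lemma openin_cantor_space_cylinder: "openin cantor_space {g. \<forall>i<k. g i = x i}"
proof (induction k)
  case 0
  show ?case using openin_topspace[of cantor_space] by simp
next
  case (Suc k)
  have "openin cantor_space {g \<in> topspace cantor_space. g k \<in> {x k}}"
    using continuous_map_cantor_space_nth by (rule openin_continuous_map_preimage) simp
  then have "openin cantor_space ({g. \<forall>i<k. g i = x i} \<inter> {g. g k = x k})"
    using Suc by (intro openin_Int) simp_all
  moreover have "{g. \<forall>i<k. g i = x i} \<inter> {g. g k = x k} = {g. \<forall>i<Suc k. g i = x i}"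
    by (auto simp: less_Suc_eq)
  ultimately show ?case by simp
qed

lemma cantor_space_open_contains_cylinder:
  assumes "openin cantor_space U" "x \<in> U"
  obtains k where "{g. \<forall>i<k. g i = x i} \<subseteq> U"
proof -
  obtain V where V: "x \<in> (\<Pi>\<^sub>E i\<in>UNIV. V i)" "finite {i. V i \<noteq> UNIV}" "(\<Pi>\<^sub>E i\<in>UNIV. V i) \<subseteq> U"
    using product_topology_open_contains_basis[OF assms] by auto
  obtain k where "\<forall>i\<in>{i. V i \<noteq> UNIV}. i < k"
    using V(2) unfolding finite_nat_set_iff_bounded by (rule exE)
  then have k: "i < k" if "V i \<noteq> UNIV" for i using that by simp
  show thesis
  proof (rule that, rule subsetI)
    fix g assume "g \<in> {g. \<forall>i<k. g i = x i}"
    then have "g i \<in> V i" for i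
      using V(1) k[of i] by (cases "V i = UNIV") (simp_all add: PiE_iff)
    then have "g \<in> (\<Pi>\<^sub>E i\<in>UNIV. V i)" by (simp add: PiE_iff)
    with V(3) show "g \<in> U" by (rule subsetD)
  qed
qed

text \<open>\<open>D\<close> is the set of free coordinates. Cylinders (\<open>D = {k..}\<close>)
  and the partition cells constructed below (\<open>D\<close> a set of odd positions) both have this
  shape.\<close>

definition subcube :: "(nat \<Rightarrow> bool) \<Rightarrow> nat set \<Rightarrow> (nat \<Rightarrow> bool) set"
  where "subcube x D = {z. \<forall>i. i \<notin> D \<longrightarrow> z i = x i}"

lemma cantor_set_subcube:
  assumes D: "infinite D"
  shows "cantor_set cantor_space (subcube x D)"
proof -
  \<comment> \<open>Enumerating \<open>D\<close> spreads the bits of \<open>g\<close> over the free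
    coordinates.\<close>
  define e where "e g i = (if i \<in> D then g (to_nat_on D i) else x i)" for g :: "nat \<Rightarrow> bool" and i
  have "continuous_map cantor_space (discrete_topology UNIV) (\<lambda>g. e g i)" for i
    by (cases "i \<in> D") (simp_all add: e_def continuous_map_cantor_space_nth)
  then have "continuous_map cantor_space cantor_space e"
    by (simp add: continuous_map_componentwise_UNIV)
  moreover have "inj e"
  proof (rule injI, rule ext)
    fix g g' n assume "e g = e g'"
    then have "e g (from_nat_into D n) = e g' (from_nat_into D n)" by simp
    then show "g n = g' n"
      using D by (simp add: e_def from_nat_into infinite_imp_nonempty)
  qed
  moreover have "range e = subcube x D"
  proof (intro equalityI subsetI)
    fix z assume z: "z \<in> subcube x D"
    have "z = e (\<lambda>n. z (from_nat_into D n))"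
      using z D by (intro ext) (simp add: e_def subcube_def countableI_type)
    then show "z \<in> range e" by blast
  qed (auto simp: e_def subcube_def)
  ultimately show ?thesis unfolding cantor_set_def by blast
qed

lemma cantor_set_image:
  assumes "continuous_map cantor_space X h" "inj h" "cantor_set cantor_space C"
  shows "cantor_set X (h ` C)"
proof -
  obtain e where e: "continuous_map cantor_space cantor_space e" "inj e" "range e = C"
    using assms(3) by (rule cantor_setE)
  have "continuous_map cantor_space X (h \<circ> e)"
    using e(1) assms(1) by (rule continuous_map_compose)
  moreover have "inj (h \<circ> e)" using assms(2) e(2) by (rule inj_compose)
  moreover have "range (h \<circ> e) = h ` C" using e(3) by auto
  ultimately show ?thesis unfolding cantor_set_def by blast
qed

text \<open>The preimage of \<open>U\<close> under a parametrisation contains a cylinder, which is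
  again a Cantor set.\<close>

lemma cantor_set_Int_open:
  assumes "cantor_set X C" "openin X U" "C \<inter> U \<noteq> {}"
  obtains C' where "cantor_set X C'" "C' \<subseteq> C \<inter> U"
proof -
  obtain h where h: "continuous_map cantor_space X h" "inj h" "range h = C"
    using assms(1) by (rule cantor_setE)
  then obtain g where g: "h g \<in> U" using assms(3) by auto
  have "openin cantor_space {z \<in> topspace cantor_space. h z \<in> U}"
    using h(1) assms(2) by (rule openin_continuous_map_preimage)
  then obtain k where k: "{z. \<forall>i<k. z i = g i} \<subseteq> {z. h z \<in> U}"
    using g by (auto elim: cantor_space_open_contains_cylinder)
  have "cantor_set X (h ` subcube g {k..})"
    using h(1,2) by (rule cantor_set_image) (simp add: cantor_set_subcube infinite_Ici)
  moreover have "h ` subcube g {k..} \<subseteq> C \<inter> U"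
  proof -
    have "subcube g {k..} \<subseteq> {z. \<forall>i<k. z i = g i}" by (simp add: subcube_def subset_iff)
    with k have "subcube g {k..} \<subseteq> {z. h z \<in> U}" by (rule subset_trans[rotated])
    with h(3) show ?thesis by blast
  qed
  ultimately show thesis by (rule that)
qed

text \<open>
  The even bits index \<open>continuum\<close> many disjoint copies of the Cantor space inside the Cantor space.
  Each \<open>t\<close> gets a copy of its own, and only the copies that are used are cut into smaller cylinders.
\<close>

lemma cantor_space_partition_refining:
  fixes T :: "'t set"
  assumes T: "|T| \<le>o continuum"
    and U: "\<And>t. t \<in> T \<Longrightarrow> openin cantor_space (U t)" "\<And>t. t \<in> T \<Longrightarrow> U t \<noteq> {}"
  obtains Q p where "partition_on UNIV Q" "\<And>q. q \<in> Q \<Longrightarrow> cantor_set cantor_space q"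
    "inj_on p T" "p ` T \<subseteq> Q" "\<And>t. t \<in> T \<Longrightarrow> p t \<subseteq> U t"
proof -
  have "\<exists>x k. {g. \<forall>i<k. g i = x i} \<subseteq> U t" if t: "t \<in> T" for t
  proof -
    obtain x where "x \<in> U t" using U(2)[OF t] by blast
    then show ?thesis by (rule cantor_space_open_contains_cylinder[OF U(1)[OF t]]) (intro exI)
  qed
  then obtain x k where xk: "\<And>t. t \<in> T \<Longrightarrow> {g. \<forall>i<k t. g i = x t i} \<subseteq> U t"
    by metis
  \<comment> \<open>The even-bit strings compatible with the cylinder of \<open>t\<close>. Only
    finitely many bits are prescribed, so there are continuum many and distinct strings
    \<open>f t\<close> can be chosen.\<close>
  define S where "S t = {g :: nat \<Rightarrow> bool. \<forall>i<k t. g i = x t (2 * i)}" for t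
  have "|T| \<le>o |S t|" for t
  proof -
    let ?j = "\<lambda>g i. if i < k t then x t (2 * i) else g (i - k t)"
    have "inj ?j"
    proof (rule injI, rule ext)
      fix g g' n assume "?j g = ?j g'"
      from fun_cong[OF this, of "n + k t"] show "g n = g' n" by simp
    qed
    moreover have "range ?j \<subseteq> S t" by (auto simp: S_def)
    ultimately have "|UNIV :: (nat \<Rightarrow> bool) set| \<le>o |S t|"
      using card_of_ordLeq by blast
    with T show ?thesis unfolding continuum_eq_card_UNIV by (rule ordLeq_transitive)
  qed
  then obtain f where f: "inj_on f T" "\<And>t. t \<in> T \<Longrightarrow> f t \<in> S t"
    using injective_choice[of T S] by blast
  define D where "D g = {i. odd i \<and> (\<forall>t\<in>T. f t = g \<longrightarrow> k t \<le> i)}" for g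
  define E where "E z = (\<lambda>i. z (2 * i))" for z :: "nat \<Rightarrow> bool"
  define cls where "cls z = subcube z (D (E z))" for z
  \<comment> \<open>A point of the copy owned by \<open>t\<close> that also agrees with
    \<open>x t\<close> at the odd positions, so that its cell lies in the cylinder of
    \<open>t\<close>.\<close>
  define z where "z t = (\<lambda>i. if even i then f t (i div 2) else x t i)" for t
  have inf: "infinite (D g)" for g
  proof -
    have "\<exists>m. \<forall>t\<in>T. f t = g \<longrightarrow> k t \<le> m"
      using f(1) by (metis inj_on_def order_refl)
    then obtain m where m: "\<forall>t\<in>T. f t = g \<longrightarrow> k t \<le> m" by blast
    have "2 * n + 1 \<in> D g" if "n \<ge> m" for n
      using m that by (force simp: D_def)
    then have "(\<lambda>n. 2 * n + 1) ` {m..} \<subseteq> D g" by auto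
    moreover have "infinite ((\<lambda>n. 2 * n + 1 :: nat) ` {m..})"
      by (subst finite_image_iff) (auto simp: inj_on_def infinite_Ici)
    ultimately show ?thesis using finite_subset by blast
  qed
  have E_cls: "E w = E v" if "w \<in> cls v" for w v
    using that by (auto simp: cls_def subcube_def E_def D_def)
  have cls_self: "v \<in> cls v" for v by (simp add: cls_def subcube_def)
  have cls_eq: "cls w = cls v" if "w \<in> cls v" for w v
    using that E_cls[OF that] by (auto simp: cls_def subcube_def)
  have Ez: "E (z t) = f t" for t by (simp add: E_def z_def)
  show thesis
  proof (rule that[of "range cls" "\<lambda>t. cls (z t)"])
    show "partition_on UNIV (range cls)"
    proof (rule partition_onI)
      show "\<Union>(range cls) = UNIV" using cls_self by blast
      show "{} \<notin> range cls" using cls_self by blast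
      show "disjnt p q" if "p \<in> range cls" "q \<in> range cls" "p \<noteq> q" for p q
        using that cls_eq unfolding disjnt_def by blast
    qed
    show "cantor_set cantor_space q" if "q \<in> range cls" for q
      using that inf cantor_set_subcube by (auto simp: cls_def)
    show "inj_on (\<lambda>t. cls (z t)) T"
    proof (rule inj_onI)
      fix t t' assume t: "t \<in> T" "t' \<in> T" and eq: "cls (z t) = cls (z t')"
      have "z t \<in> cls (z t')" using cls_self[of "z t"] unfolding eq .
      from E_cls[OF this] have "f t = f t'" by (simp add: Ez)
      then show "t = t'" using f(1) t by (simp add: inj_on_eq_iff)
    qed
    show "(\<lambda>t. cls (z t)) ` T \<subseteq> range cls" by blast
    show "cls (z t) \<subseteq> U t" if t: "t \<in> T" for t
    proof
      fix w assume w: "w \<in> cls (z t)"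
      have "w i = x t i" if i: "i < k t" for i
      proof -
        have "i \<notin> D (E (z t))" using t i by (auto simp: D_def Ez)
        then have "w i = z t i" using w by (simp add: cls_def subcube_def)
        moreover have "z t i = x t i"
          using f(2)[OF t] i by (auto simp: z_def S_def)
        ultimately show ?thesis by simp
      qed
      with xk[OF t] show "w \<in> U t" by blast
    qed
  qed
qed

text \<open>The result for the Cantor space itself, carried over by an injective parametrisation of
  \<open>C\<close>. It serves to cut continuum many prescribed small pieces out of a single Cantor
  set.\<close>

lemma cantor_set_partition_refining:
  fixes T :: "'t set"
  assumes C: "cantor_set X C" and T: "|T| \<le>o continuum"
    and U: "\<And>t. t \<in> T \<Longrightarrow> openin X (U t)" "\<And>t. t \<in> T \<Longrightarrow> C \<inter> U t \<noteq> {}"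
  obtains Q p where "partition_on C Q" "\<And>q. q \<in> Q \<Longrightarrow> cantor_set X q"
    "inj_on p T" "p ` T \<subseteq> Q" "\<And>t. t \<in> T \<Longrightarrow> p t \<subseteq> U t"
proof -
  obtain h where h: "continuous_map cantor_space X h" "inj h" "range h = C"
    using C by (rule cantor_setE)
  have op: "openin cantor_space (h -` U t)" if "t \<in> T" for t
    using openin_continuous_map_preimage[OF h(1) U(1)[OF that]] by (simp add: vimage_def)
  have ne: "h -` U t \<noteq> {}" if "t \<in> T" for t using U(2)[OF that] h(3) by auto
  obtain Q p where Q: "partition_on UNIV Q" "\<And>q. q \<in> Q \<Longrightarrow> cantor_set cantor_space q"
      "inj_on p T" "p ` T \<subseteq> Q" "\<And>t. t \<in> T \<Longrightarrow> p t \<subseteq> h -` U t"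
    using cantor_space_partition_refining[of T "\<lambda>t. h -` U t", OF T op ne] by blast
  show ?thesis
  proof (rule that[of "(`) h ` Q" "\<lambda>t. h ` p t"])
    show "partition_on C ((`) h ` Q)"
    proof (rule partition_onI)
      show "\<Union>((`) h ` Q) = C" by (simp add: h(3)[symmetric] partition_onD1[OF Q(1)] image_Union)
      show "{} \<notin> (`) h ` Q" using partition_onD3[OF Q(1)] by blast
      fix a b assume "a \<in> (`) h ` Q" "b \<in> (`) h ` Q" "a \<noteq> b"
      then obtain a' b' where ab: "a = h ` a'" "b = h ` b'" "a' \<in> Q" "b' \<in> Q" "a' \<noteq> b'" by blast
      then have "a' \<inter> b' = {}" by (intro disjointD[OF partition_onD2[OF Q(1)]])
      then show "disjnt a b" by (simp add: ab disjnt_def image_Int[OF h(2), symmetric])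
    qed
    show "inj_on (\<lambda>t. h ` p t) T"
      using Q(3) h(2) by (simp add: inj_on_def inj_image_eq_iff)
    show "cantor_set X q" if "q \<in> (`) h ` Q" for q
      using that Q(2) cantor_set_image[OF h(1,2)] by blast
    show "(\<lambda>t. h ` p t) ` T \<subseteq> (`) h ` Q" using Q(4) by blast
    show "h ` p t \<subseteq> U t" if "t \<in> T" for t using Q(5)[OF that] by blast
  qed
qed

text \<open>Without the zero sequence, the Cantor space is the disjoint union of the cylinders of
  0^n 1, each a copy of the whole. Send the \<open>n\<close>-th one onto \<open>P n\<close> and the
  zero sequence to \<open>y\<close>; convergence of the \<open>P n\<close> to \<open>y\<close> gives
  continuity there.\<close>

lemma (in Metric_space) cantor_set_insert_sequence:
  fixes P :: "nat \<Rightarrow> 'a set"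
  assumes y: "y \<in> M" "\<And>n. y \<notin> P n" and P: "\<And>n. cantor_set mtopology (P n)"
    and disj: "\<And>m n. m \<noteq> n \<Longrightarrow> P m \<inter> P n = {}"
    and lim: "\<And>\<epsilon>. \<epsilon> > 0 \<Longrightarrow> \<exists>N. \<forall>n\<ge>N. P n \<subseteq> mball y \<epsilon>"
  shows "cantor_set mtopology (insert y (\<Union>n. P n))"
proof -
  obtain h where h: "\<And>n. continuous_map cantor_space mtopology (h n)" "\<And>n. inj (h n)"
      "\<And>n. range (h n) = P n"
    using P unfolding cantor_set_def by metis
  \<comment> \<open>\<open>code n u\<close> is the string 0^n 1 followed by \<open>u\<close>; the
    map \<open>H\<close> decodes it at the first one.\<close>
  define code where "code n u = (\<lambda>i. if i < n then False else if i = n then True else u (i - Suc n))"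
    for n and u :: "nat \<Rightarrow> bool"
  define H where "H (g :: nat \<Rightarrow> bool) = (if g = (\<lambda>_. False) then y else
      h (LEAST n. g n) (\<lambda>i. g (i + Suc (LEAST n. g n))))" for g
  have H_code: "H (code n u) = h n u" for n u
  proof -
    have "(LEAST n'. code n u n') = n"
      by (rule Least_equality) (auto simp: code_def split: if_splits)
    moreover have "code n u \<noteq> (\<lambda>_. False)" by (auto simp: code_def fun_eq_iff)
    ultimately show ?thesis unfolding H_def by (simp add: code_def)
  qed
  have H_zero: "H (\<lambda>_. False) = y" by (simp add: H_def)
  have agree: "g = code n (\<lambda>i. g (i + Suc n))" if "\<forall>i<n. \<not> g i" "g n" for g n
    using that by (auto simp: code_def fun_eq_iff)
  have ex: "\<exists>n u. g = code n u" if nz: "g \<noteq> (\<lambda>_. False)" for g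
  proof -
    obtain m where "g m" using nz by auto
    then have "g (LEAST n. g n)" by (rule LeastI)
    then show ?thesis using agree not_less_Least by blast
  qed
  have hM: "h n u \<in> M" for n u
    using h(1)[of n] by (auto simp: continuous_map_def)
  have HM: "H g \<in> M" for g
  proof (cases "g = (\<lambda>_. False)")
    case False
    then obtain n u where "g = code n u" using ex by blast
    then show ?thesis using hM by (simp add: H_code)
  qed (simp add: H_zero y(1))
  have cont: "continuous_map cantor_space mtopology H"
    unfolding continuous_map_to_metric
  proof (intro ballI allI impI)
    fix g and \<epsilon> :: real assume \<epsilon>: "\<epsilon> > 0"
    show "\<exists>U. openin cantor_space U \<and> g \<in> U \<and> (\<forall>y\<in>U. H y \<in> mball (H g) \<epsilon>)"
    proof (cases "g = (\<lambda>_. False)")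
      case True
      obtain N where N: "\<And>n. n \<ge> N \<Longrightarrow> P n \<subseteq> mball y \<epsilon>" using lim[OF \<epsilon>] by blast
      \<comment> \<open>If \<open>N\<close> leading bits vanish, the first one, if any, sits at a
        position \<open>n \<ge> N\<close>.\<close>
      have "H g' \<in> mball y \<epsilon>" if g': "\<forall>i<N. g' i = g i" for g'
      proof (cases "g' = (\<lambda>_. False)")
        case True
        then show ?thesis using H_zero y(1) \<epsilon> by simp
      next
        case False
        then obtain n u where nu: "g' = code n u" using ex by blast
        have "g' n" by (simp add: nu code_def)
        then have "n \<ge> N" using g' True by (metis not_le)
        moreover have "H g' \<in> P n" using h(3)[of n] by (auto simp: nu H_code)
        ultimately show ?thesis using N by blast
      qed
      then show ?thesis
        using openin_cantor_space_cylinder[of N g] True H_zero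
        by (intro exI[of _ "{g'. \<forall>i<N. g' i = g i}"]) auto
    next
      case False
      then obtain n u where nu: "g = code n u" using ex by blast
      obtain V where V: "openin cantor_space V" "u \<in> V" "\<forall>v\<in>V. h n v \<in> mball (h n u) \<epsilon>"
        using h(1)[of n, unfolded continuous_map_to_metric, rule_format, of u, OF _ \<epsilon>] by auto
      let ?sh = "\<lambda>g i. g (i + Suc n)"
      have "continuous_map cantor_space cantor_space ?sh"
        unfolding continuous_map_componentwise_UNIV using continuous_map_cantor_space_nth by simp
      from openin_continuous_map_preimage[OF this V(1)]
      have "openin cantor_space {g'. ?sh g' \<in> V}" by simp
      \<comment> \<open>Fixing the first \<open>Suc n\<close> bits keeps the first one at position
        \<open>n\<close>, so on this set \<open>H\<close> is \<open>h n\<close> after the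
        shift.\<close>
      then have "openin cantor_space ({g'. ?sh g' \<in> V} \<inter> {g'. \<forall>i<Suc n. g' i = g i})"
        using openin_cantor_space_cylinder by (rule openin_Int)
      moreover have "?sh g = u" by (simp add: nu code_def)
      moreover have "H g' \<in> mball (H g) \<epsilon>" if g': "?sh g' \<in> V" "\<forall>i<Suc n. g' i = g i" for g'
      proof -
        have "g' = code n (?sh g')"
          using g'(2) by (intro agree) (auto simp: nu code_def)
        then have "H g' = h n (?sh g')" using H_code by metis
        then show ?thesis using V(3) g'(1) by (simp add: nu H_code)
      qed
      ultimately show ?thesis
        using V(2) by (intro exI[of _ "{g'. ?sh g' \<in> V} \<inter> {g'. \<forall>i<Suc n. g' i = g i}"]) auto
    qed
  qed
  have "inj H"
  proof (rule injI)
    fix g g' assume eq: "H g = H g'"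
    have h_in: "h n u \<in> P n" for n u using h(3) by blast
    have zero: False if "H (code n u) = y" for n u
      using that y(2)[of n] h_in[of n u] by (simp add: H_code)
    show "g = g'"
    proof (cases "g = (\<lambda>_. False)")
      case True
      show ?thesis
      proof (rule ccontr)
        assume "g \<noteq> g'"
        then have "g' \<noteq> (\<lambda>_. False)" using True by simp
        then obtain n u where "g' = code n u" using ex by blast
        then show False using zero[of n u] eq True H_zero by simp
      qed
    next
      case g: False
      then obtain n u where nu: "g = code n u" using ex by blast
      have "g' \<noteq> (\<lambda>_. False)" using zero[of n u] eq nu H_zero by auto
      then obtain n' u' where nu': "g' = code n' u'" using ex by blast
      have h_eq: "h n u = h n' u'" using eq by (simp add: nu nu' H_code)
      have "n = n'"
      proof (rule ccontr)
        assume "n \<noteq> n'"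
        from disj[OF this] h_in[of n u] h_in[of n' u'] h_eq show False by auto
      qed
      moreover from this have "u = u'" using h_eq by (simp add: inj_eq[OF h(2)])
      ultimately show ?thesis by (simp add: nu nu')
    qed
  qed
  moreover have "range H = insert y (\<Union>n. P n)"
  proof (intro equalityI subsetI)
    fix v assume "v \<in> range H"
    then obtain g where g: "v = H g" by blast
    show "v \<in> insert y (\<Union>n. P n)"
    proof (cases "g = (\<lambda>_. False)")
      case False
      then obtain n u where "g = code n u" using ex by blast
      then have "v \<in> P n" using h(3)[of n] g by (auto simp: H_code)
      then show ?thesis by blast
    qed (simp add: g H_zero)
  next
    fix v assume "v \<in> insert y (\<Union>n. P n)"
    then consider "v = y" | n where "v \<in> P n" by blast
    then show "v \<in> range H"
    proof cases
      case 1
      then show ?thesis using H_zero by blast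
    next
      case 2
      then obtain u where "v = h n u" using h(3)[of n] by blast
      then show ?thesis using H_code[of n u] by (metis rangeI)
    qed
  qed
  ultimately show ?thesis using cont unfolding cantor_set_def by blast
qed

subsection \<open>Absorbing the uncovered points\<close>

text \<open>Zorn's lemma gives a maximal disjoint family. If it missed a nonempty open set, a Cantor
  set through a point of that set would contain a smaller one inside it, which could be
  added.\<close>

lemma exists_dense_disjoint_cantor_sets:
  assumes cov: "\<And>x. x \<in> topspace X \<Longrightarrow> \<exists>C. cantor_set X C \<and> x \<in> C"
  obtains \<A> where "disjoint \<A>" "\<And>A. A \<in> \<A> \<Longrightarrow> cantor_set X A"
    "\<And>U. openin X U \<Longrightarrow> U \<noteq> {} \<Longrightarrow> \<exists>A\<in>\<A>. A \<inter> U \<noteq> {}"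
proof -
  define \<F> where "\<F> = {\<A>. disjoint \<A> \<and> (\<forall>A\<in>\<A>. cantor_set X A)}"
  have "\<exists>\<A>\<in>\<F>. \<forall>\<B>\<in>\<F>. \<A> \<subseteq> \<B> \<longrightarrow> \<B> = \<A>"
  proof (rule subset_Zorn')
    fix \<C> assume \<C>: "subset.chain \<F> \<C>"
    have "disjnt A B" if AB: "A \<in> \<Union>\<C>" "B \<in> \<Union>\<C>" "A \<noteq> B" for A B
    proof -
      obtain \<A> \<B> where *: "\<A> \<in> \<C>" "A \<in> \<A>" "\<B> \<in> \<C>" "B \<in> \<B>" using AB by blast
      then have "\<A> \<subseteq> \<B> \<or> \<B> \<subseteq> \<A>" using \<C> by (auto simp: subset.chain_def)
      then obtain \<D> where "\<D> \<in> \<C>" "A \<in> \<D>" "B \<in> \<D>" using * by blast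
      moreover from this have "disjoint \<D>" using \<C> by (auto simp: subset.chain_def \<F>_def)
      ultimately show ?thesis using AB(3) by (simp add: pairwise_def)
    qed
    moreover have "cantor_set X A" if "A \<in> \<Union>\<C>" for A
      using that \<C> by (auto simp: subset.chain_def \<F>_def)
    ultimately show "\<Union>\<C> \<in> \<F>" by (simp add: \<F>_def pairwise_def)
  qed
  then obtain \<A> where \<A>: "\<A> \<in> \<F>" "\<And>\<B>. \<B> \<in> \<F> \<Longrightarrow> \<A> \<subseteq> \<B> \<Longrightarrow> \<B> = \<A>" by blast
  have "\<exists>A\<in>\<A>. A \<inter> U \<noteq> {}" if U: "openin X U" "U \<noteq> {}" for U
  proof (rule ccontr)
    assume "\<not> (\<exists>A\<in>\<A>. A \<inter> U \<noteq> {})"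
    then have no: "\<And>A. A \<in> \<A> \<Longrightarrow> A \<inter> U = {}" by blast
    obtain x where x: "x \<in> U" using U(2) by blast
    then obtain C where C: "cantor_set X C" "x \<in> C"
      using cov openin_subset[OF U(1)] by blast
    then obtain C' where C': "cantor_set X C'" "C' \<subseteq> C \<inter> U"
      using cantor_set_Int_open[OF C(1) U(1)] x by blast
    have disj: "A \<inter> C' = {}" if "A \<in> \<A>" for A using no[OF that] C'(2) by blast
    have "insert C' \<A> \<in> \<F>"
      using \<A>(1) C'(1) disj by (auto simp: \<F>_def pairwise_insert disjnt_def)
    \<comment> \<open>By maximality \<open>C'\<close> is already a member, hence disjoint from
      itself although nonempty.\<close>
    then have "C' \<in> \<A>" using \<A>(2) by blast
    with disj[of C'] cantor_set_nonempty[OF C'(1)] show False by simp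
  qed
  then show thesis using that[of \<A>] \<A>(1) by (simp add: \<F>_def)
qed

section \<open>Capturing sequences of small Cantor sets, and the size of balls\<close>

context Metric_space
begin

abbreviation (input) dball :: "nat \<Rightarrow> 'a \<Rightarrow> 'a set"
  where "dball n x \<equiv> mball x (1 / 2 ^ n)"

lemma dball_subset_open:
  assumes "openin mtopology U" "x \<in> U"
  obtains n where "dball n x \<subseteq> U"
proof -
  obtain r where r: "r > 0" "mball x r \<subseteq> U"
    using assms unfolding openin_mtopology by blast
  obtain n where "(1 / 2 :: real) ^ n < r"
    using real_arch_pow_inv[OF r(1), of "1 / 2"] by auto
  then have "dball n x \<subseteq> mball x r"
    by (intro mball_subset_concentric) (simp add: power_one_over)
  with r(2) that show thesis by blast
qed

text \<open>Each uncovered \<open>y\<close> is joined with its own pieces \<open>p (y, n)\<close>,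
  which shrink to \<open>y\<close> and so form a Cantor set with it. Injectivity of \<open>p\<close>
  on all pairs keeps these sets disjoint, and the pieces nobody captured stay as they are.\<close>

lemma partition_of_captured_sets:
  fixes p :: "'a \<times> nat \<Rightarrow> 'a set"
  assumes disj: "disjoint \<Q>" and \<Q>: "\<And>q. q \<in> \<Q> \<Longrightarrow> cantor_set mtopology q"
    and Y: "Y = M - \<Union>\<Q>"
    and inj: "inj_on p (Y \<times> UNIV)" and p: "\<And>y n. y \<in> Y \<Longrightarrow> p (y, n) \<in> \<Q>"
    and sub: "\<And>y n. y \<in> Y \<Longrightarrow> p (y, n) \<subseteq> dball n y"
  obtains P where "partition_on M P" "\<And>C. C \<in> P \<Longrightarrow> cantor_set mtopology C"
proof -
  define F where "F y = insert y (\<Union>n. p (y, n))" for y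
  define \<R> where "\<R> = \<Q> - p ` (Y \<times> UNIV)"
  have YQ: "y \<notin> q" if "y \<in> Y" "q \<in> \<Q>" for y q using that Y by blast
  have QM: "q \<subseteq> M" if "q \<in> \<Q>" for q
    using cantor_set_subset_topspace[OF \<Q>[OF that]] by simp
  have Qne: "q \<noteq> {}" if "q \<in> \<Q>" for q
    using cantor_set_nonempty[OF \<Q>[OF that]] .
  have Qdisj: "a \<inter> b = {}" if "a \<in> \<Q>" "b \<in> \<Q>" "a \<noteq> b" for a b
    using disjointD[OF disj that] .
  have p_disj: "p (y, n) \<inter> p (z, k) = {}" if "y \<in> Y" "z \<in> Y" "(y, n) \<noteq> (z, k)" for y z n k
    by (rule Qdisj[OF p p]) (use that inj_onD[OF inj, of "(y, n)" "(z, k)"] in auto)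
  have F_cantor: "cantor_set mtopology (F y)" if y: "y \<in> Y" for y
    unfolding F_def
  proof (rule cantor_set_insert_sequence)
    show "y \<in> M" using y Y by blast
    show "y \<notin> p (y, n)" for n using YQ[OF y p[OF y]] .
    show "cantor_set mtopology (p (y, n))" for n using \<Q>[OF p[OF y]] .
    show "p (y, m) \<inter> p (y, n) = {}" if "m \<noteq> n" for m n using p_disj[OF y y] that by simp
    fix \<epsilon> :: real assume "\<epsilon> > 0"
    then obtain N where N: "dball N y \<subseteq> mball y \<epsilon>"
      using dball_subset_open[of "mball y \<epsilon>" y] \<open>y \<in> M\<close> by auto
    have "p (y, n) \<subseteq> mball y \<epsilon>" if "n \<ge> N" for n
    proof -
      have "dball n y \<subseteq> dball N y"
        using that by (intro mball_subset_concentric) (simp add: frac_le)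
      then show ?thesis using sub[OF y, of n] N by blast
    qed
    then show "\<exists>N. \<forall>n\<ge>N. p (y, n) \<subseteq> mball y \<epsilon>" by blast
  qed
  have FF: "F y \<inter> F z = {}" if "y \<in> Y" "z \<in> Y" "y \<noteq> z" for y z
  proof -
    have "p (y, n) \<inter> p (z, k) = {}" for n k using p_disj that by simp
    moreover have "y \<notin> p (z, k)" "z \<notin> p (y, k)" for k using YQ p that by simp_all
    ultimately show ?thesis using \<open>y \<noteq> z\<close> unfolding F_def by blast
  qed
  have FR: "F y \<inter> r = {}" if y: "y \<in> Y" and r: "r \<in> \<R>" for y r
  proof -
    have "p (y, n) \<inter> r = {}" for n
      by (rule Qdisj) (use y r p in \<open>auto simp: \<R>_def\<close>)
    moreover have "y \<notin> r" using YQ[OF y] r by (simp add: \<R>_def)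
    ultimately show ?thesis unfolding F_def by blast
  qed
  show thesis
  proof (rule that[of "\<R> \<union> F ` Y"])
    show "partition_on M (\<R> \<union> F ` Y)"
    proof (rule partition_onI)
      show "\<Union>(\<R> \<union> F ` Y) = M"
      proof (intro equalityI subsetI)
        fix x assume "x \<in> \<Union>(\<R> \<union> F ` Y)"
        moreover have "F y \<subseteq> M" if "y \<in> Y" for y
          using cantor_set_subset_topspace[OF F_cantor[OF that]] by simp
        ultimately show "x \<in> M" using QM by (auto simp: \<R>_def)
      next
        fix x assume x: "x \<in> M"
        show "x \<in> \<Union>(\<R> \<union> F ` Y)"
        proof (cases "x \<in> Y")
          case True
          then show ?thesis by (auto simp: F_def)
        next
          case False
          then obtain q where "q \<in> \<Q>" "x \<in> q" using x Y by blast
          then show ?thesis unfolding \<R>_def F_def by blast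
        qed
      qed
      show "{} \<notin> \<R> \<union> F ` Y"
        using Qne by (auto simp: \<R>_def F_def)
      fix a b assume "a \<in> \<R> \<union> F ` Y" "b \<in> \<R> \<union> F ` Y" "a \<noteq> b"
      then consider "a \<in> \<Q>" "b \<in> \<Q>" | y where "y \<in> Y" "a = F y" "b \<in> \<R>"
        | z where "z \<in> Y" "b = F z" "a \<in> \<R>"
        | y z where "y \<in> Y" "z \<in> Y" "y \<noteq> z" "a = F y" "b = F z"
        unfolding \<R>_def by blast
      then have "a \<inter> b = {}"
      proof cases
        case 1 then show ?thesis using Qdisj \<open>a \<noteq> b\<close> by simp
      next
        case 2 then show ?thesis using FR by simp
      next
        case 3 then show ?thesis using FR by (simp add: Int_commute)
      next
        case 4 then show ?thesis using FF by simp
      qed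
      then show "disjnt a b" by (simp add: disjnt_def)
    qed
    show "cantor_set mtopology C" if "C \<in> \<R> \<union> F ` Y" for C
      using that F_cantor \<Q> by (auto simp: \<R>_def)
  qed
qed

lemma card_of_dball_ordLeq_meeting_sets:
  assumes S: "card_le_continuum_plus_omega M"
    and \<A>: "\<And>A. A \<in> \<A> \<Longrightarrow> cantor_set mtopology A"
    and dense: "\<And>U. openin mtopology U \<Longrightarrow> U \<noteq> {} \<Longrightarrow> \<exists>A\<in>\<A>. A \<inter> U \<noteq> {}"
    and x: "x \<in> M"
  shows "|dball k x| \<le>o |{A \<in> \<A>. A \<inter> dball k x \<noteq> {}} \<times> (UNIV :: (nat \<Rightarrow> bool) set)|"
    (is "_ \<le>o |?L|")
proof (rule ordLeq_of_ordLeq_cexp_natLeq[OF S mball_subset_mspace])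
  have opn: "openin mtopology (mball z r)" for z r by (rule openin_mball)
  have "x \<in> dball k x" using x by simp
  then obtain A where "A \<in> \<A>" "A \<inter> dball k x \<noteq> {}"
    using dense[OF opn, of x "1 / 2 ^ k"] by blast
  \<comment> \<open>A single member meeting the ball already contributes continuum many
    pairs.\<close>
  then have "Pair A ` UNIV \<subseteq> ?L" by auto
  then have "\<exists>f. inj_on f (UNIV :: (nat \<Rightarrow> bool) set) \<and> f ` UNIV \<subseteq> ?L"
    by (intro exI[of _ "Pair A"]) (simp add: inj_on_def)
  then show "continuum \<le>o |?L|"
    unfolding continuum_eq_card_UNIV by (rule card_of_ordLeq[THEN iffD1])
  obtain h :: "'a set \<Rightarrow> (nat \<Rightarrow> bool) \<Rightarrow> 'a" where h: "\<And>A. A \<in> \<A> \<Longrightarrow> range (h A) = A"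
  proof -
    have "\<forall>A\<in>\<A>. \<exists>g :: (nat \<Rightarrow> bool) \<Rightarrow> 'a. range g = A"
    proof
      fix A assume "A \<in> \<A>"
      then obtain g :: "(nat \<Rightarrow> bool) \<Rightarrow> 'a" where "range g = A"
        by (rule cantor_setE[OF \<A>])
      then show "\<exists>g :: (nat \<Rightarrow> bool) \<Rightarrow> 'a. range g = A" by blast
    qed
    then obtain h where "\<forall>A\<in>\<A>. range (h A :: (nat \<Rightarrow> bool) \<Rightarrow> 'a) = A"
      unfolding bchoice_iff by (rule exE)
    then show thesis using that[of h] by simp
  qed
  have ex: "\<exists>l\<in>?L. h (fst l) (snd l) \<in> dball n z" if z: "z \<in> dball k x" for z n
  proof -
    have zM: "z \<in> M" using z by simp
    \<comment> \<open>Intersecting with \<open>dball k x\<close> forces the member found by density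
      to meet that ball, as \<open>?L\<close> demands.\<close>
    have "openin mtopology (dball k x \<inter> dball n z)" by (intro openin_Int opn)
    moreover have "z \<in> dball k x \<inter> dball n z" using z zM by simp
    ultimately obtain A where A: "A \<in> \<A>" "A \<inter> (dball k x \<inter> dball n z) \<noteq> {}"
      using dense by blast
    then obtain v where v: "v \<in> A" "v \<in> dball n z" by blast
    have "v \<in> range (h A)" using v(1) h[OF A(1)] by simp
    then obtain g where g: "v = h A g" by (rule rangeE)
    have "(A, g) \<in> ?L" using A by blast
    moreover have "h (fst (A, g)) (snd (A, g)) \<in> dball n z" using v(2) by (simp only: g fst_conv snd_conv)
    ultimately show ?thesis by (rule bexI[rotated])
  qed
  define s where "s z n = (SOME l. l \<in> ?L \<and> h (fst l) (snd l) \<in> dball n z)" for z n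
  have s: "s z n \<in> ?L" "h (fst (s z n)) (snd (s z n)) \<in> dball n z" if "z \<in> dball k x" for z n
  proof -
    from ex[OF that, of n] have "\<exists>l. l \<in> ?L \<and> h (fst l) (snd l) \<in> dball n z" by (simp only: Bex_def)
    note * = someI_ex[OF this, folded s_def]
    show "s z n \<in> ?L" using * by (rule conjunct1)
    show "h (fst (s z n)) (snd (s z n)) \<in> dball n z" using * by (rule conjunct2)
  qed
  have "inj_on s (dball k x)"
  proof (rule inj_onI, rule ccontr)
    fix z w assume zw: "z \<in> dball k x" "w \<in> dball k x" "s z = s w" "z \<noteq> w"
    have M: "z \<in> M" "w \<in> M" using zw by simp_all
    then have pos: "d z w / 2 > 0" using zw(4) by simp
    obtain n where n: "dball n z \<subseteq> mball z (d z w / 2)"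
      using dball_subset_open[OF opn] M(1) pos by (metis centre_in_mball_iff)
    obtain m where m: "dball m w \<subseteq> mball w (d z w / 2)"
      using dball_subset_open[OF opn] M(2) pos by (metis centre_in_mball_iff)
    \<comment> \<open>At this index the common named point would lie in the balls of radius
      \<open>d z w / 2\<close> around both \<open>z\<close> and \<open>w\<close>, which are
      disjoint.\<close>
    define j where "j = max n m"
    let ?v = "h (fst (s z j)) (snd (s z j))"
    have "?v \<in> dball j z" "?v \<in> dball j w" using s(2)[OF zw(1), of j] s(2)[OF zw(2), of j] zw(3) by simp_all
    moreover have "dball j z \<subseteq> dball n z" "dball j w \<subseteq> dball m w"
      by (intro mball_subset_concentric; simp add: j_def frac_le)+
    ultimately have v: "?v \<in> mball z (d z w / 2)" "?v \<in> mball w (d z w / 2)" using n m by blast+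
    then have "?v \<in> M" "d z ?v < d z w / 2" "d w ?v < d z w / 2" by simp_all
    then show False using triangle[of z ?v w] M by (simp add: commute)
  qed
  moreover have "s ` dball k x \<subseteq> Func UNIV ?L"
    using s(1) by (auto simp: Func_def)
  ultimately have "|dball k x| \<le>o |Func (UNIV :: nat set) ?L|"
    using card_of_ordLeq by blast
  then show "|dball k x| \<le>o |?L| ^c natLeq"
    by (simp add: cexp_def Field_natLeq Field_card_of)
qed

section \<open>Stable radii and linked classes\<close>

text \<open>
  Radius \<open>2^-m\<close> is stable at \<open>y\<close> when smaller balls around \<open>y\<close> are no smaller in cardinality.  Stable
  points at distance less than \<open>2^-m\<close> see equally large balls, so a chain of such points stays within
  a set no larger than any of those balls, and different chain components have disjoint
  \<open>2^-(m+1)\<close>-neighbourhoods.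
\<close>

definition stable :: "nat \<Rightarrow> 'a set"
  where "stable m = {y \<in> M. \<forall>k. |dball m y| \<le>o |dball k y|}"

definition linked :: "nat \<Rightarrow> ('a \<times> 'a) set"
  where "linked m = {(a, b). a \<in> stable m \<and> b \<in> stable m \<and> d a b < 1 / 2 ^ m}"

text \<open>Cardinals are well-ordered, so some ball around \<open>y\<close> has the least
  cardinality.\<close>

lemma stable_exists:
  assumes "y \<in> M"
  shows "\<exists>m. y \<in> stable m"
proof -
  have "\<exists>r\<in>range (\<lambda>m. |dball m y| ). \<forall>r'\<in>range (\<lambda>m. |dball m y| ). r \<le>o r'"
    by (rule exists_minim_Card_order) (auto simp: card_of_Card_order)
  then obtain m where "\<forall>r'\<in>range (\<lambda>m. |dball m y| ). |dball m y| \<le>o r'" by blast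
  with assms have "y \<in> stable m" by (simp add: stable_def)
  then show ?thesis ..
qed

lemma sym_linked: "sym (linked m)"
  by (auto simp: linked_def sym_def commute)

lemma linked_class_eq:
  assumes "(a, b) \<in> (linked m)\<^sup>*"
  shows "(linked m)\<^sup>* `` {a} = (linked m)\<^sup>* `` {b}"
proof -
  have "(b, a) \<in> (linked m)\<^sup>*" using assms sym_rtrancl[OF sym_linked] by (rule symD[rotated])
  with assms show ?thesis by (auto intro: rtrancl_trans)
qed

text \<open>For one link from \<open>b\<close> to \<open>c\<close>, the open ball
  \<open>dball m b\<close> contains a small ball around \<open>c\<close>, which by stability is as
  large as \<open>dball m c\<close>. As links are symmetric, all balls of this radius along a class
  are equinumerous.\<close>

lemma linked_class_dball:
  assumes "(a, b) \<in> (linked m)\<^sup>*"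
  shows "|dball m b| \<le>o |dball m a|"
  using assms
proof (induction rule: rtrancl_induct)
  case base
  show ?case by (rule ordLeq_refl[OF card_of_Card_order])
next
  case (step b c)
  then have bc: "b \<in> M" "c \<in> stable m" "c \<in> dball m b"
    by (auto simp: linked_def stable_def)
  obtain k where "dball k c \<subseteq> dball m b"
    using dball_subset_open[OF openin_mball bc(3)] .
  moreover have "|dball m c| \<le>o |dball k c|" using bc(2) by (simp add: stable_def)
  ultimately have "|dball m c| \<le>o |dball m b|"
    using ordLeq_transitive[OF _ card_of_mono1] by blast
  with step.IH show ?case by (rule ordLeq_transitive[rotated])
qed

lemma linked_class_subset: "a \<in> stable m \<Longrightarrow> (linked m)\<^sup>* `` {a} \<subseteq> stable m"
  by (auto simp: linked_def elim: rtranclE)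

text \<open>The neighbours of \<open>b\<close> lie in \<open>dball m b\<close>, which is no larger
  than \<open>dball m a\<close>. So the points reachable in \<open>n\<close> links stay within this
  cardinality, and the class is their union over all \<open>n\<close>.\<close>

lemma card_of_linked_class:
  assumes inf: "infinite (dball m a)"
  shows "|(linked m)\<^sup>* `` {a}| \<le>o |dball m a|"
proof -
  have natLeq: "|UNIV :: nat set| \<le>o |dball m a|"
    using inf infinite_iff_card_of_nat by blast
  have "|(linked m ^^ n) `` {a}| \<le>o |dball m a|" for n
  proof (induction n)
    case 0
    have "(linked m ^^ 0) `` {a} = {a}" by auto
    moreover have "|{a}| \<le>o |dball m a|"
      using inf by (intro card_of_singl_ordLeq) auto
    ultimately show ?case by simp
  next
    case (Suc n)
    have eq: "(linked m ^^ Suc n) `` {a} = (\<Union>b\<in>(linked m ^^ n) `` {a}. linked m `` {b})" by auto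
    have "|linked m `` {b}| \<le>o |dball m a|" if b: "b \<in> (linked m ^^ n) `` {a}" for b
    proof -
      have "linked m `` {b} \<subseteq> dball m b"
        by (auto simp: linked_def stable_def)
      moreover have "(a, b) \<in> (linked m)\<^sup>*" using b by (auto intro: relpow_imp_rtrancl)
      ultimately show ?thesis
        by (intro ordLeq_transitive[OF card_of_mono1 linked_class_dball])
    qed
    then show ?case unfolding eq
      by (intro card_of_UNION_ordLeq_infinite[OF inf Suc.IH]) blast
  qed
  then have "|\<Union>n. (linked m ^^ n) `` {a}| \<le>o |dball m a|"
    by (intro card_of_UNION_ordLeq_infinite[OF inf natLeq]) blast
  moreover have "(linked m)\<^sup>* `` {a} = (\<Union>n. (linked m ^^ n) `` {a})"
    by (auto simp: rtrancl_power)
  ultimately show ?thesis by simp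
qed

text \<open>The class times \<open>nat\<close> is no larger than \<open>dball m y\<close>. By
  stability every smaller ball around a point of the class is at least that large, hence so is the
  supply of labelled members meeting it; thus an injective choice exists. The bit sequences are
  labels that let one member serve continuum many pairs.\<close>

lemma injective_capture_on_linked_class:
  assumes S: "card_le_continuum_plus_omega M"
    and \<A>: "\<And>A. A \<in> \<A> \<Longrightarrow> cantor_set mtopology A"
    and dense: "\<And>U. openin mtopology U \<Longrightarrow> U \<noteq> {} \<Longrightarrow> \<exists>A\<in>\<A>. A \<inter> U \<noteq> {}"
    and y: "y \<in> stable m"
  shows "\<exists>f :: 'a \<times> nat \<Rightarrow> 'a set \<times> (nat \<Rightarrow> bool). inj_on f ((linked m)\<^sup>* `` {y} \<times> UNIV) \<and>
    (\<forall>z\<in>(linked m)\<^sup>* `` {y}. \<forall>n. fst (f (z, n)) \<in> \<A> \<and> fst (f (z, n)) \<inter> dball (Suc (m + n)) z \<noteq> {})"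
proof -
  let ?E = "(linked m)\<^sup>* `` {y}"
  \<comment> \<open>The index \<open>Suc (m + n)\<close> makes the radii shrink with
    \<open>n\<close> and keeps them at most 2^-(m+1), half the linking distance.\<close>
  define S where "S i = {A \<in> \<A>. A \<inter> dball (Suc (m + snd i)) (fst i) \<noteq> {}} \<times> (UNIV :: (nat \<Rightarrow> bool) set)"
    for i :: "'a \<times> nat"
  have yM: "y \<in> M" using y by (simp add: stable_def)
  then have "y \<in> dball m y" by simp
  then obtain A where A: "A \<in> \<A>" "A \<inter> dball m y \<noteq> {}"
    using dense[OF openin_mball, of y "1 / 2 ^ m"] by blast
  \<comment> \<open>The ball contains a Cantor set and is therefore infinite, as the cardinal bounds
    on the class require.\<close>
  obtain C where C: "cantor_set mtopology C" "C \<subseteq> A \<inter> dball m y"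
    using cantor_set_Int_open[OF \<A>[OF A(1)] openin_mball A(2)] .
  have "infinite C"
  proof -
    obtain h :: "(nat \<Rightarrow> bool) \<Rightarrow> 'a" where h: "inj h" "range h = C"
      using C(1) by (rule cantor_setE)
    have "infinite (UNIV :: (nat \<Rightarrow> bool) set)"
      by (rule infinite_of_continuum) (simp add: continuum_eq_card_UNIV ordLeq_refl card_of_Card_order)
    then show ?thesis using h finite_imageD[of h UNIV] by auto
  qed
  then have inf: "infinite (dball m y)" using C(2) finite_subset by blast
  have EU: "|?E \<times> (UNIV :: nat set)| \<le>o |dball m y|"
    by (rule card_of_Sigma_ordLeq_infinite[OF inf card_of_linked_class[OF inf]])
      (use inf infinite_iff_card_of_nat in blast)
  have le: "|?E \<times> (UNIV :: nat set)| \<le>o |S i|" if i: "i \<in> ?E \<times> UNIV" for i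
  proof -
    obtain z n where zn: "i = (z, n)" "z \<in> ?E" using i by blast
    have z: "z \<in> stable m" using zn linked_class_subset[OF y] by blast
    have "(z, y) \<in> (linked m)\<^sup>*" using zn(2) sym_rtrancl[OF sym_linked] by (auto dest: symD)
    then have "|dball m y| \<le>o |dball m z|" by (rule linked_class_dball)
    also have "|dball m z| \<le>o |dball (Suc (m + n)) z|" using z by (simp only: stable_def) blast
    also have "|dball (Suc (m + n)) z| \<le>o |S i|"
      unfolding S_def zn(1) fst_conv snd_conv
      by (rule card_of_dball_ordLeq_meeting_sets[OF S \<A> dense]) (use z in \<open>simp_all add: stable_def\<close>)
    finally show ?thesis by (rule ordLeq_transitive[OF EU])
  qed
  obtain f where f: "inj_on f (?E \<times> UNIV)" "\<And>i. i \<in> ?E \<times> UNIV \<Longrightarrow> f i \<in> S i"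
    using injective_choice[of "?E \<times> UNIV" S, OF le] by blast
  have "fst (f (z, n)) \<in> \<A> \<and> fst (f (z, n)) \<inter> dball (Suc (m + n)) z \<noteq> {}" if "z \<in> ?E" for z n
    using f(2)[of "(z, n)"] that by (auto simp: S_def)
  with f(1) show ?thesis by blast
qed

text \<open>To count the captures from one \<open>A\<close>, fix a level \<open>m\<close> and a
  point \<open>x\<close> of \<open>A\<close>: the pairs whose ball contains \<open>x\<close> come
  from one linked class, where the choice is injective up to the label. So there are at most
  continuum many, and \<open>A\<close> has at most continuum many points for each of countably many
  levels.\<close>

lemma continuum_to_one_capture:
  assumes S: "card_le_continuum_plus_omega M"
    and \<A>: "\<And>A. A \<in> \<A> \<Longrightarrow> cantor_set mtopology A"
    and dense: "\<And>U. openin mtopology U \<Longrightarrow> U \<noteq> {} \<Longrightarrow> \<exists>A\<in>\<A>. A \<inter> U \<noteq> {}"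
  obtains \<phi> :: "'a \<times> nat \<Rightarrow> 'a set"
  where "\<And>y n. y \<in> M \<Longrightarrow> \<phi> (y, n) \<in> \<A>" "\<And>y n. y \<in> M \<Longrightarrow> \<phi> (y, n) \<inter> dball n y \<noteq> {}"
    "\<And>A. A \<in> \<A> \<Longrightarrow> |{(y, n). y \<in> M \<and> \<phi> (y, n) = A}| \<le>o continuum"
proof -
  define good where "good m E f \<longleftrightarrow> inj_on f (E \<times> UNIV) \<and>
      (\<forall>z\<in>E. \<forall>n. fst (f (z, n)) \<in> \<A> \<and> fst (f (z, n)) \<inter> dball (Suc (m + n)) z \<noteq> {})"
    for m E and f :: "'a \<times> nat \<Rightarrow> 'a set \<times> (nat \<Rightarrow> bool)"
  \<comment> \<open>The choice depends only on the level and the class, so that all points of one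
    class share the same injective function.\<close>
  define \<Psi> where "\<Psi> m E = (SOME f. good m E f)" for m E
  define \<mu> where "\<mu> y = (SOME m. y \<in> stable m)" for y
  define E where "E y = (linked (\<mu> y))\<^sup>* `` {y}" for y
  define \<phi> where "\<phi> = (\<lambda>(y, n). fst (\<Psi> (\<mu> y) (E y) (y, n)))"
  have \<mu>: "y \<in> stable (\<mu> y)" if "y \<in> M" for y
    unfolding \<mu>_def using stable_exists[OF that] by (rule someI_ex)
  have good: "good (\<mu> y) (E y) (\<Psi> (\<mu> y) (E y))" if "y \<in> M" for y
  proof -
    have "\<exists>f. good (\<mu> y) (E y) f"
      unfolding good_def E_def by (rule injective_capture_on_linked_class[OF S \<A> dense \<mu>[OF that]])
    then show ?thesis unfolding \<Psi>_def by (rule someI_ex)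
  qed
  have self: "y \<in> E y" for y by (simp add: E_def)
  have \<phi>: "\<phi> (y, n) \<in> \<A>" "\<phi> (y, n) \<inter> dball (Suc (\<mu> y + n)) y \<noteq> {}" if "y \<in> M" for y n
    using good[OF that] self[of y] by (simp_all add: good_def \<phi>_def)
  have near: "|{(y, n). y \<in> M \<and> \<mu> y = m \<and> \<phi> (y, n) = A \<and> x \<in> dball (Suc (m + n)) y}| \<le>o continuum"
    (is "|?W| \<le>o _") for m A x
  proof -
    have same: "E y = E z" if "(y, n) \<in> ?W" "(z, k) \<in> ?W" for y z n k
    proof -
      have yz: "y \<in> M" "z \<in> M" "x \<in> M" "\<mu> y = m" "\<mu> z = m"
        and d: "d y x < 1 / 2 ^ Suc (m + n)" "d z x < 1 / 2 ^ Suc (m + k)"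
        using that by auto
      have "(1 :: real) / 2 ^ Suc (m + j) \<le> 1 / 2 ^ Suc m" for j
        by (intro divide_left_mono power_increasing) auto
      then have "d y x < 1 / 2 ^ Suc m" "d z x < 1 / 2 ^ Suc m"
        using d by (auto intro: less_le_trans)
      moreover have "d y z \<le> d y x + d z x"
        using triangle[of y x z] yz by (simp add: commute)
      \<comment> \<open>Two distances below 2^-(m+1) add up to less than the linking
        distance.\<close>
      ultimately have "d y z < 1 / 2 ^ m" by simp
      then have "(y, z) \<in> linked m"
        using \<mu>[of y] \<mu>[of z] yz by (simp add: linked_def)
      then show ?thesis
        using linked_class_eq[OF r_into_rtrancl] yz by (simp add: E_def)
    qed
    show ?thesis
    proof (cases "?W = {}")
      case True
      show ?thesis unfolding True continuum_eq_card_UNIV by (rule card_of_empty)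
    next
      case False
      then obtain y0 n0 where y0: "(y0, n0) \<in> ?W" by auto
      let ?f = "\<Psi> m (E y0)"
      have inj: "inj_on ?f (E y0 \<times> UNIV)"
        using good[of y0] y0 by (auto simp: good_def)
      have mem: "i \<in> E y0 \<times> UNIV \<and> fst (?f i) = A" if i: "i \<in> ?W" for i
      proof -
        obtain y n where yn: "i = (y, n)" by (cases i)
        then have "E y = E y0" using same i y0 by blast
        then show ?thesis using i self[of y] by (auto simp: yn \<phi>_def)
      qed
      \<comment> \<open>On \<open>?W\<close> the first component is constantly \<open>A\<close>, so
        the labels alone separate the pairs.\<close>
      have "inj_on (\<lambda>i. snd (?f i)) ?W"
      proof (rule inj_onI)
        fix i j assume ij: "i \<in> ?W" "j \<in> ?W" "snd (?f i) = snd (?f j)"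
        then have "?f i = ?f j" using mem[OF ij(1)] mem[OF ij(2)] by (simp add: prod_eq_iff)
        then show "i = j" using inj_onD[OF inj] mem ij by blast
      qed
      then have "\<exists>g :: 'a \<times> nat \<Rightarrow> nat \<Rightarrow> bool. inj_on g ?W \<and> g ` ?W \<subseteq> UNIV"
        by blast
      then show ?thesis
        unfolding continuum_eq_card_UNIV by (rule card_of_ordLeq[THEN iffD1])
    qed
  qed
  have "|{(y, n). y \<in> M \<and> \<phi> (y, n) = A}| \<le>o continuum" if A: "A \<in> \<A>" for A
  proof -
    let ?W = "\<lambda>m x. {(y, n). y \<in> M \<and> \<mu> y = m \<and> \<phi> (y, n) = A \<and> x \<in> dball (Suc (m + n)) y}"
    let ?c = "UNIV :: (nat \<Rightarrow> bool) set"
    have inf: "infinite ?c"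
      by (rule infinite_of_continuum) (simp add: continuum_eq_card_UNIV ordLeq_refl card_of_Card_order)
    have "|\<Union>x\<in>A. ?W m x| \<le>o |?c|" for m
      using card_of_cantor_set[OF \<A>[OF A]] near
      unfolding continuum_eq_card_UNIV by (intro card_of_UNION_ordLeq_infinite[OF inf]) blast+
    then have "|\<Union>m. \<Union>x\<in>A. ?W m x| \<le>o |?c|"
      using inf by (intro card_of_UNION_ordLeq_infinite[OF inf]) (auto simp: infinite_iff_card_of_nat)
    moreover have "{(y, n). y \<in> M \<and> \<phi> (y, n) = A} \<subseteq> (\<Union>m. \<Union>x\<in>A. ?W m x)"
    proof (rule subsetI)
      fix i assume "i \<in> {(y, n). y \<in> M \<and> \<phi> (y, n) = A}"
      then obtain y n where yn: "i = (y, n)" "y \<in> M" "\<phi> (y, n) = A" by blast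
      obtain x where "x \<in> A" "x \<in> dball (Suc (\<mu> y + n)) y"
        using \<phi>(2)[OF yn(2), of n] yn(3) by blast
      then show "i \<in> (\<Union>m. \<Union>x\<in>A. ?W m x)" using yn by blast
    qed
    ultimately show ?thesis
      unfolding continuum_eq_card_UNIV by (blast intro: ordLeq_transitive[OF card_of_mono1])
  qed
  moreover have "\<phi> (y, n) \<inter> dball n y \<noteq> {}" if "y \<in> M" for y n
  proof -
    have "dball (Suc (\<mu> y + n)) y \<subseteq> dball n y"
      by (intro mball_subset_concentric divide_left_mono power_increasing) auto
    then show ?thesis using \<phi>(2)[OF that, of n] by blast
  qed
  ultimately show thesis using that[of \<phi>] \<phi>(1) by blast
qed

text \<open>Every member \<open>A\<close> is partitioned so finely that each pair capturing from it
  finds its own cell inside the prescribed ball. The cells of all members, with the uncovered points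
  absorbed, give the partition.\<close>

lemma cantor_partition_exists:
  assumes S: "card_le_continuum_plus_omega M"
    and cov: "\<And>x. x \<in> M \<Longrightarrow> \<exists>C. cantor_set mtopology C \<and> x \<in> C"
  obtains P where "partition_on M P" "\<And>C. C \<in> P \<Longrightarrow> cantor_set mtopology C"
proof -
  obtain \<A> where \<A>: "disjoint \<A>" "\<And>A. A \<in> \<A> \<Longrightarrow> cantor_set mtopology A"
    "\<And>U. openin mtopology U \<Longrightarrow> U \<noteq> {} \<Longrightarrow> \<exists>A\<in>\<A>. A \<inter> U \<noteq> {}"
    using exists_dense_disjoint_cantor_sets[of mtopology] cov by auto
  obtain \<phi> :: "'a \<times> nat \<Rightarrow> 'a set" where \<phi>: "\<And>y n. y \<in> M \<Longrightarrow> \<phi> (y, n) \<in> \<A>"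
    "\<And>y n. y \<in> M \<Longrightarrow> \<phi> (y, n) \<inter> dball n y \<noteq> {}"
    "\<And>A. A \<in> \<A> \<Longrightarrow> |{(y, n). y \<in> M \<and> \<phi> (y, n) = A}| \<le>o continuum"
    using continuum_to_one_capture[OF S \<A>(2,3)] by blast
  \<comment> \<open>The demands made on \<open>A\<close>, one cell for each.\<close>
  define T where "T A = {(y, n). y \<in> M \<and> \<phi> (y, n) = A}" for A
  have "\<exists>Q p. partition_on A Q \<and> (\<forall>q\<in>Q. cantor_set mtopology q) \<and> inj_on p (T A) \<and> p ` T A \<subseteq> Q
      \<and> (\<forall>t\<in>T A. p t \<subseteq> dball (snd t) (fst t))" if A: "A \<in> \<A>" for A
  proof -
    have T: "|T A| \<le>o continuum" using \<phi>(3)[OF A] by (simp only: T_def)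
    have ne: "A \<inter> dball (snd t) (fst t) \<noteq> {}" if "t \<in> T A" for t
      using that \<phi>(2)[of "fst t" "snd t"] by (auto simp: T_def)
    show ?thesis
      by (rule cantor_set_partition_refining[OF \<A>(2)[OF A] T openin_mball ne]) blast+
  qed
  then have "\<forall>A\<in>\<A>. \<exists>Qp. partition_on A (fst Qp) \<and> (\<forall>q\<in>fst Qp. cantor_set mtopology q)
      \<and> inj_on (snd Qp) (T A) \<and> snd Qp ` T A \<subseteq> fst Qp
      \<and> (\<forall>t\<in>T A. snd Qp t \<subseteq> dball (snd t) (fst t))"
    by simp
  then obtain Qp where Qp: "\<forall>A\<in>\<A>. partition_on A (fst (Qp A)) \<and> (\<forall>q\<in>fst (Qp A). cantor_set mtopology q)
      \<and> inj_on (snd (Qp A)) (T A) \<and> snd (Qp A) ` T A \<subseteq> fst (Qp A)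
      \<and> (\<forall>t\<in>T A. snd (Qp A) t \<subseteq> dball (snd t) (fst t))"
    unfolding bchoice_iff by (rule exE)
  define Q where "Q A = fst (Qp A)" for A
  define p where "p A = snd (Qp A)" for A
  have part: "partition_on A (Q A)" and cant: "\<And>q. q \<in> Q A \<Longrightarrow> cantor_set mtopology q"
    and inj: "inj_on (p A) (T A)" and img: "\<And>t. t \<in> T A \<Longrightarrow> p A t \<in> Q A"
    and sub: "\<And>t. t \<in> T A \<Longrightarrow> p A t \<subseteq> dball (snd t) (fst t)" if "A \<in> \<A>" for A
    using Qp that by (auto simp: Q_def p_def)
  have Q_sub: "q \<subseteq> A" if "A \<in> \<A>" "q \<in> Q A" for A q
    using partition_onD1[OF part[OF that(1)]] that(2) by blast
  have same: "A = B" if "A \<in> \<A>" "B \<in> \<A>" "q \<in> Q A" "r \<in> Q B" "q \<inter> r \<noteq> {}" for A B q r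
    using disjointD[OF \<A>(1) that(1,2)] Q_sub[OF that(1,3)] Q_sub[OF that(2,4)] that(5) by blast
  \<comment> \<open>The cells of \<open>Q A\<close> exhaust \<open>A\<close>, so the points outside
    \<open>\<Union>\<Q>\<close> are exactly those outside \<open>\<Union>\<A>\<close>.\<close>
  define \<Q> where "\<Q> = (\<Union>A\<in>\<A>. Q A)"
  define p' where "p' t = p (\<phi> t) t" for t
  have tT: "t \<in> T (\<phi> t)" "\<phi> t \<in> \<A>" if "t \<in> M \<times> UNIV" for t
    using that \<phi>(1) by (auto simp: T_def)
  show thesis
  proof (rule partition_of_captured_sets[OF _ _ refl, of \<Q> p'])
    show "disjoint \<Q>"
    proof (rule disjointI)
      fix q r assume "q \<in> \<Q>" "r \<in> \<Q>" "q \<noteq> r"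
      then obtain A B where AB: "A \<in> \<A>" "q \<in> Q A" "B \<in> \<A>" "r \<in> Q B" by (auto simp: \<Q>_def)
      show "q \<inter> r = {}"
      proof (rule ccontr)
        assume ne: "q \<inter> r \<noteq> {}"
        then have "A = B" using same AB by blast
        then show False
          using disjointD[OF partition_onD2[OF part[OF AB(1)]] AB(2)] AB(4) \<open>q \<noteq> r\<close> ne by blast
      qed
    qed
    show "cantor_set mtopology q" if "q \<in> \<Q>" for q
      using that cant by (auto simp: \<Q>_def)
    show "inj_on p' ((M - \<Union>\<Q>) \<times> UNIV)"
    proof (rule inj_onI)
      fix t u assume "t \<in> (M - \<Union>\<Q>) \<times> UNIV" "u \<in> (M - \<Union>\<Q>) \<times> UNIV" and eq: "p' t = p' u"
      then have tu: "t \<in> M \<times> UNIV" "u \<in> M \<times> UNIV" by auto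
      note t = tT[OF tu(1)] and u = tT[OF tu(2)]
      have "p' t \<in> Q (\<phi> t)" "p' u \<in> Q (\<phi> u)" unfolding p'_def by (intro img t u)+
      moreover from this have "p' t \<inter> p' u \<noteq> {}"
        using cantor_set_nonempty[OF cant[OF t(2)]] by (simp add: eq)
      \<comment> \<open>Cells of different members are disjoint, so equal cells come from one
        member, where \<open>p\<close> is injective on its demands.\<close>
      ultimately have "\<phi> t = \<phi> u" using same[OF t(2) u(2)] by blast
      then show "t = u" using inj_onD[OF inj[OF t(2)] _ t(1)] u(1) eq by (simp add: p'_def)
    qed
    show "p' (y, n) \<in> \<Q>" if "y \<in> M - \<Union>\<Q>" for y n
      using that tT[of "(y, n)"] img by (auto simp: p'_def \<Q>_def)
    show "p' (y, n) \<subseteq> dball n y" if "y \<in> M - \<Union>\<Q>" for y n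
      using that tT[of "(y, n)"] sub[of "\<phi> (y, n)" "(y, n)"] by (simp add: p'_def)
  qed (rule that)
qed

end

theorem theorem3p5:
  fixes X :: "'a topology"
  assumes "metrizable_space X"
    and "card_le_continuum_plus_omega (topspace X)"
  shows "cantor_partitionable X \<longleftrightarrow> cantor_coverable X"
proof
  assume "cantor_partitionable X"
  then show "cantor_coverable X"
    unfolding cantor_partitionable_def cantor_coverable_def by (metis partition_onD1)
next
  assume "cantor_coverable X"
  then obtain K where K: "\<Union>K = topspace X"
      "\<And>C. C \<in> K \<Longrightarrow> subtopology X C homeomorphic_space cantor_space"
    unfolding cantor_coverable_def by blast
  obtain M d where "Metric_space M d" and X: "X = Metric_space.mtopology M d"
    using assms(1) unfolding metrizable_space_def by blast
  then interpret Metric_space M d by simp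
  have hX: "Hausdorff_space X" unfolding X by (rule Hausdorff_space_mtopology)
  have M: "topspace X = M" by (simp add: X)
  have cov: "\<exists>C. cantor_set mtopology C \<and> x \<in> C" if "x \<in> M" for x
  proof -
    have "x \<in> \<Union>K" using that by (simp only: K(1) M)
    then obtain C where C: "C \<in> K" "x \<in> C" by blast
    from C(1) have "C \<subseteq> topspace X" unfolding K(1)[symmetric] by (rule Union_upper)
    from homeomorphic_cantor_space_iff[OF hX this] K(2)[OF C(1)]
    have "cantor_set mtopology C" unfolding X by (rule iffD1)
    with C(2) show ?thesis by blast
  qed
  obtain P where P: "partition_on M P" "\<And>C. C \<in> P \<Longrightarrow> cantor_set mtopology C"
    using cantor_partition_exists[OF assms(2)[unfolded M] cov] by blast
  have "subtopology X C homeomorphic_space cantor_space" if "C \<in> P" for C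
    by (rule homeomorphic_cantor_space_iff[OF hX, THEN iffD2])
      (use P(2)[OF that] cantor_set_subset_topspace in \<open>simp_all only: X\<close>)
  with P(1) show "cantor_partitionable X"
    unfolding cantor_partitionable_def M by blast
qed

end
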